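(* For any matrix $A\in\mathbb{R}^{m\times n}$ and constant $p \in\mathbb{Q}\cap(2, \infty)$, $\|A\|_{p_u}$ can be obtained by the optimal value of problem (P) below such that $$ \|A\|_{p_u}\le \|A\|_{p_*}\le {\delta_G}\|A\|_{p_u}. $$ Moreover, any optimal solution $Z\in\mathbb{R}^{m\times n}$ of (P) is an approximate dual certificate of $\|A\|_{p_*}$ in the sense that $$ \|Z\|_{p_\sigma}\le 1 \text{ and } \langle A,Z\rangle\ge \|A\|_{p_*}/\delta_G. $$ Here (P) is the conic optimization problem $$ \begin{array}{ll} \max & \langle A,Z\rangle \\ \textnormal{s.t.} & u_1+ u_2+\theta_p\sum_{i=1}^{m+n} t_i\le 1\\ & (v_i, u_1,t_i)\in\mathbb{K}^3_p\quad i=1,2,\dots, m \\ & (v_i, u_2,t_i)\in\mathbb{K}^3_p\quad i=m+1,m+2,\dots, m+n\\ & D(\boldsymbol{v})\succeq \begin{pmatrix} O & Z/2 \\ Z^{\textnormal{T}}/2 & O\end{pmatrix}, \end{array} $$ with variables $Z\in\mathbb{R}^{m\times n}$, $u_1,u_2\in\mathbb{R}$, $\boldsymbol{v},\boldsymbol{t}\in\mathbb{R}^{m+n}$.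
   Context: For $p\in[1,\infty]$ let $q$ satisfy $\frac1p+\frac1q=1$. For a matrix $A\in\mathbb{R}^{m\times n}$, the spectral $p$-norm is $\|A\|_{p_\sigma}=\max\{\boldsymbol{x}^{\textnormal{T}}A\boldsymbol{y}:\|\boldsymbol{x}\|_p=\|\boldsymbol{y}\|_p=1\}$ and the nuclear $p$-norm is $\|A\|_{p_*}=\min\{\sum_{i=1}^r|\lambda_i|: A=\sum_{i=1}^r\lambda_i\boldsymbol{x}_i\boldsymbol{y}_i^{\textnormal{T}},\ \|\boldsymbol{x}_i\|_p=\|\boldsymbol{y}_i\|_p=1,\ r\in\mathbb{N}\}$; these norms are dual to each other. Define $$ \|A\|_{p_v}:= \max \left\{\left\langle \begin{pmatrix} O & A/2 \\ A^{\textnormal{T}}/2 & O \end{pmatrix}, X\right\rangle: \sum_{i=1}^m|x_{i i}|^{p/2} \le 1,\ \sum_{i=m+1}^{m+n}|x_{ii}|^{p/2} \le 1,\ X \succeq O\right\} $$ and $\|A\|_{p_u}:=\max\{\langle A,Z\rangle:\|Z\|_{p_v}\le 1\}$. $\delta_G$ is the Grothendieck constant. $D(\boldsymbol{v})$ denotes the diagonal matrix with diagonal $\boldsymbol{v}$. $\theta_p:=(2/p)^{2/(p-2)}-(2/p)^{p/(p-2)}>0$. $\mathbb{K}^3_p:=\{(u,v,t)\in\mathbb{R}_+^3:v^{p/(p-2)}\le t u^{2/(p-2)}\}$; in (P) the membership "$(v_i,u_1,t_i)\in\mathbb{K}^3_p$" is used to mean $u_1,v_i,t_i\ge0$ and $v_i^{p/(p-2)}\le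 t_i u_1^{2/(p-2)}$ (and similarly with $u_2$). $\mathbb{K}^3_p$ is second-order cone representable, so (P) is a polynomial-size SDP. *)

theory Defs
  imports Complex_Main
begin

text \<open>Matrices in R^{m x n} are represented as functions nat => nat => real, only the
  entries with row index < m and column index < n being relevant; vectors in R^k are
  functions nat => real with index < k.  Indices are 0-based.\<close>

definition vec_pnorm :: "real \<Rightarrow> nat \<Rightarrow> (nat \<Rightarrow> real) \<Rightarrow> real" where
  "vec_pnorm p k x = (\<Sum>i<k. \<bar>x i\<bar> powr p) powr (1 / p)"

definition bilin :: "nat \<Rightarrow> nat \<Rightarrow> (nat \<Rightarrow> real) \<Rightarrow> (nat \<Rightarrow> nat \<Rightarrow> real) \<Rightarrow> (nat \<Rightarrow> real) \<Rightarrow> real" where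
  "bilin m n x A y = (\<Sum>i<m. \<Sum>j<n. x i * A i j * y j)"

definition mat_inner :: "nat \<Rightarrow> nat \<Rightarrow> (nat \<Rightarrow> nat \<Rightarrow> real) \<Rightarrow> (nat \<Rightarrow> nat \<Rightarrow> real) \<Rightarrow> real" where
  "mat_inner m n A B = (\<Sum>i<m. \<Sum>j<n. A i j * B i j)"

definition spectral_pnorm :: "real \<Rightarrow> nat \<Rightarrow> nat \<Rightarrow> (nat \<Rightarrow> nat \<Rightarrow> real) \<Rightarrow> real" where
  "spectral_pnorm p m n A =
     Sup {bilin m n x A y | x y. vec_pnorm p m x = 1 \<and> vec_pnorm p n y = 1}"

definition nuclear_pnorm :: "real \<Rightarrow> nat \<Rightarrow> nat \<Rightarrow> (nat \<Rightarrow> nat \<Rightarrow> real) \<Rightarrow> real" where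
  "nuclear_pnorm p m n A =
     Inf {(\<Sum>k<r. \<bar>lam k\<bar>) | (r::nat) (lam::nat \<Rightarrow> real) (xs::nat \<Rightarrow> nat \<Rightarrow> real) (ys::nat \<Rightarrow> nat \<Rightarrow> real).
            (\<forall>k<r. vec_pnorm p m (xs k) = 1 \<and> vec_pnorm p n (ys k) = 1) \<and>
            (\<forall>i<m. \<forall>j<n. A i j = (\<Sum>k<r. lam k * xs k i * ys k j))}"

definition psd :: "nat \<Rightarrow> (nat \<Rightarrow> nat \<Rightarrow> real) \<Rightarrow> bool" where
  "psd k X \<longleftrightarrow> (\<forall>i<k. \<forall>j<k. X i j = X j i) \<and>
     (\<forall>w. (\<Sum>i<k. \<Sum>j<k. w i * X i j * w j) \<ge> 0)"

definition blk :: "nat \<Rightarrow> nat \<Rightarrow> (nat \<Rightarrow> nat \<Rightarrow> real) \<Rightarrow> nat \<Rightarrow> nat \<Rightarrow> real" where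
  "blk m n A i j =
     (if i < m \<and> m \<le> j \<and> j < m + n then A i (j - m) / 2
      else if m \<le> i \<and> i < m + n \<and> j < m then A j (i - m) / 2
      else 0)"

definition diag_mat :: "(nat \<Rightarrow> real) \<Rightarrow> nat \<Rightarrow> nat \<Rightarrow> real" where
  "diag_mat v i j = (if i = j then v i else 0)"

definition pv_norm :: "real \<Rightarrow> nat \<Rightarrow> nat \<Rightarrow> (nat \<Rightarrow> nat \<Rightarrow> real) \<Rightarrow> real" where
  "pv_norm p m n A =
     Sup {mat_inner (m + n) (m + n) (blk m n A) X | X.
            (\<Sum>i<m. \<bar>X i i\<bar> powr (p / 2)) \<le> 1 \<and>
            (\<Sum>i\<in>{m..<m+n}. \<bar>X i i\<bar> powr (p / 2)) \<le> 1 \<and>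
            psd (m + n) X}"

definition pu_norm :: "real \<Rightarrow> nat \<Rightarrow> nat \<Rightarrow> (nat \<Rightarrow> nat \<Rightarrow> real) \<Rightarrow> real" where
  "pu_norm p m n A = Sup {mat_inner m n A Z | Z. pv_norm p m n Z \<le> 1}"

definition grothendieck_constant :: real where
  "grothendieck_constant =
     Inf {K. \<forall>(m::nat) (n::nat) (A::nat \<Rightarrow> nat \<Rightarrow> real) (d::nat)
               (u::nat \<Rightarrow> nat \<Rightarrow> real) (v::nat \<Rightarrow> nat \<Rightarrow> real).
             (\<forall>i<m. (\<Sum>k<d. (u i k)\<^sup>2) = 1) \<and> (\<forall>j<n. (\<Sum>k<d. (v j k)\<^sup>2) = 1) \<longrightarrow>
             (\<Sum>i<m. \<Sum>j<n. A i j * (\<Sum>k<d. u i k * v j k)) \<le>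
               K * Sup {bilin m n s A t | s t. (\<forall>i<m. \<bar>s i\<bar> = 1) \<and> (\<forall>j<n. \<bar>t j\<bar> = 1)}}"

definition theta :: "real \<Rightarrow> real" where
  "theta p = (2 / p) powr (2 / (p - 2)) - (2 / p) powr (p / (p - 2))"

definition in_Kp :: "real \<Rightarrow> real \<Rightarrow> real \<Rightarrow> real \<Rightarrow> bool" where
  "in_Kp p v u t \<longleftrightarrow> u \<ge> 0 \<and> v \<ge> 0 \<and> t \<ge> 0 \<and> v powr (p / (p - 2)) \<le> t * u powr (2 / (p - 2))"

definition P_feasible :: "real \<Rightarrow> nat \<Rightarrow> nat \<Rightarrow> (nat \<Rightarrow> nat \<Rightarrow> real) \<Rightarrow> real \<Rightarrow> real
    \<Rightarrow> (nat \<Rightarrow> real) \<Rightarrow> (nat \<Rightarrow> real) \<Rightarrow> bool" where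
  "P_feasible p m n Z u1 u2 v t \<longleftrightarrow>
     u1 + u2 + theta p * (\<Sum>i<m+n. t i) \<le> 1 \<and>
     (\<forall>i<m. in_Kp p (v i) u1 (t i)) \<and>
     (\<forall>i\<in>{m..<m+n}. in_Kp p (v i) u2 (t i)) \<and>
     psd (m + n) (\<lambda>i j. diag_mat v i j - blk m n Z i j)"

definition P_value :: "real \<Rightarrow> nat \<Rightarrow> nat \<Rightarrow> (nat \<Rightarrow> nat \<Rightarrow> real) \<Rightarrow> real" where
  "P_value p m n A =
     Sup {mat_inner m n A Z | Z u1 u2 v t. P_feasible p m n Z u1 u2 v t}"

end

theory Submission
  imports Defs "HOL-Analysis.Convex"
begin

text \<open>A positive semidefinite \<open>X\<close> is a Gram matrix, so Grothendieck's inequality applied to the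
  matrix \<open>A\<close> rescaled by \<open>sqrt (X i i)\<close> gives
  \<open>spectral \<le> pv \<le> grothendieck_constant * spectral\<close>; dualising this, with the duality of
  nuclear and spectral norm obtained from a separating hyperplane, gives the two-sided bound.
  That the constant is finite, as the infimum defining it requires, follows by truncating
  Rademacher sums. Pointwise weighted AM-GM shows that the matrices feasible for (P) have
  \<open>pv\<close> norm at most 1. Conversely, if \<open>pv Z \<le> 1\<close>, then separating \<open>D(v) - blk Z\<close> from the positive
  semidefinite cone shows that \<open>c Z\<close> is feasible for every \<open>c < 1\<close>; this suffices for the suprema to
  agree and avoids a compactness argument.\<close>

subsection \<open>Positive semidefinite matrices\<close>

text \<open>Real suprema and infima are unspecified on empty or unbounded sets, so each norm needs a
  witness and a bound before it can be compared with another. Positive \<open>m\<close> and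
  \<open>n\<close> supply unit vectors. The bounds form a chain: entrywise absolute sums bound the
  spectral norm, Grothendieck's inequality bounds pv, the nuclear norm bounds pu, and pu bounds (P).
  Finiteness of the Grothendieck constant rests on absorption: truncation errors are again Gram
  forms, of size at most 7/8 of the supremum that is being estimated, so that supremum bounds
  itself. No extremum is shown to be attained. Dual certificates are built for every level strictly
  below the nuclear norm, and the conic constraints are met only up to an error that a multiple of
  the identity repairs. Separation is therefore stated for a convex set at positive distance from
  the origin; that distance comes from an explicit estimate in the nuclear case and from the negated
  approximation claim in the conic case.\<close>

lemma sum_lessThan_add:
  fixes f :: "nat \<Rightarrow> 'a::comm_monoid_add"
  shows "(\<Sum>i<m+n. f i) = (\<Sum>i<m. f i) + (\<Sum>j<n. f (m + j))"
  by (induction n) (simp_all add: add.assoc)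

lemma sum_atLeastLessThan_add:
  fixes f :: "nat \<Rightarrow> 'a::comm_monoid_add"
  shows "(\<Sum>i\<in>{m..<m+n}. f i) = (\<Sum>j<n. f (m + j))"
  using sum.shift_bounds_nat_ivl[of f 0 m n] by (simp add: lessThan_atLeast0 add.commute)

lemma sum_split_blocks:
  fixes f :: "nat \<Rightarrow> real"
  shows "(\<Sum>i<m + n. f i) = (\<Sum>i<m. f i) + (\<Sum>i\<in>{m..<m+n}. f i)"
  by (simp only: sum_lessThan_add sum_atLeastLessThan_add)

definition quad_form :: "nat \<Rightarrow> (nat \<Rightarrow> nat \<Rightarrow> real) \<Rightarrow> (nat \<Rightarrow> real) \<Rightarrow> real" where
  "quad_form k X w = (\<Sum>i<k. \<Sum>j<k. w i * X i j * w j)"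

lemma psd_iff:
  "psd k X \<longleftrightarrow> (\<forall>i<k. \<forall>j<k. X i j = X j i) \<and> (\<forall>w. 0 \<le> quad_form k X w)"
  by (simp add: psd_def quad_form_def)

lemma quad_form_cong:
  assumes "\<And>i. i < k \<Longrightarrow> w i = z i"
  shows "quad_form k X w = quad_form k X z"
  unfolding quad_form_def by (intro sum.cong refl) (use assms in simp)

lemma quad_form_Suc:
  assumes "\<forall>i<Suc k. \<forall>j<Suc k. X i j = X j i"
  shows "quad_form (Suc k) X w =
    quad_form k X w + 2 * w k * (\<Sum>i<k. w i * X i k) + (w k)\<^sup>2 * X k k"
proof -
  have "(\<Sum>j<k. w k * X k j * w j) = (\<Sum>i<k. w i * X i k * w k)"
    using assms by (intro sum.cong refl) (simp add: mult_ac)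
  moreover have "(\<Sum>i<k. w i * X i k * w k) = w k * (\<Sum>i<k. w i * X i k)"
    by (simp add: sum_distrib_left mult_ac)
  ultimately show ?thesis
    by (simp add: quad_form_def sum.distrib power2_eq_square algebra_simps)
qed

lemma quad_form_unit:
  assumes "i < k"
  shows "quad_form k X (\<lambda>j. if j = i then 1 else 0) = X i i"
proof -
  have "quad_form k X (\<lambda>j. if j = i then 1 else 0) = (\<Sum>a<k. if a = i then (\<Sum>j<k. if j = i then X i i else 0) else 0)"
    unfolding quad_form_def by (intro sum.cong refl) (auto simp: if_distrib cong: if_cong)
  also have "\<dots> = X i i"
    using assms by simp
  finally show ?thesis .
qed

lemma psd_diag_nonneg:
  assumes "psd k X" "i < k"
  shows "0 \<le> X i i"
  using assms quad_form_unit[OF assms(2), of X] by (metis psd_iff)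

text \<open>On the coordinates \<open>i\<close> and \<open>k\<close> the form is
  \<open>X i i + 2 * s * X i k\<close>, affine in \<open>s\<close> because the pivot vanishes, hence
  unbounded below unless \<open>X i k = 0\<close>; \<open>s\<close> is chosen to give -1.\<close>

lemma psd_zero_last:
  assumes psd: "psd (Suc k) X" and zero: "X k k = 0" and i: "i < k"
  shows "X i k = 0"
proof (rule ccontr)
  assume nz: "X i k \<noteq> 0"
  define s where "s = - (X i i + 1) / (2 * X i k)"
  define w where "w = (\<lambda>j. if j = i then 1 else if j = k then s else (0::real))"
  have "quad_form k X w = X i i"
    using quad_form_unit[OF i, of X] by (subst quad_form_cong[of k w]) (auto simp: w_def)
  moreover have "(\<Sum>j<k. w j * X j k) = X i k"
  proof -
    have "(\<Sum>j<k. w j * X j k) = (\<Sum>j<k. if j = i then X i k else 0)"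
      by (intro sum.cong refl) (auto simp: w_def)
    then show ?thesis using i by simp
  qed
  moreover have "w k = s" using i by (simp add: w_def)
  ultimately have "quad_form (Suc k) X w = X i i + 2 * s * X i k"
    using psd by (subst quad_form_Suc) (auto simp: psd_iff zero)
  also have "\<dots> = -1" using nz by (simp add: s_def field_simps)
  finally show False using psd by (auto simp: psd_iff dest: spec[of _ w])
qed

text \<open>Cholesky factorisation by Schur complements; if the pivot \<open>X k k\<close> vanishes,
  then \<open>x / 0 = 0\<close> makes all correction terms vanish as well.\<close>

lemma psd_gram:
  assumes "psd k X"
  shows "\<exists>g. \<forall>i<k. \<forall>j<k. X i j = (\<Sum>l<k. g i l * g j l)"
  using assms
proof (induction k arbitrary: X)
  case 0
  then show ?case by simp
next
  case (Suc k)
  define a where "a = X k k"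
  define Y where "Y = (\<lambda>i j. X i j - X i k * X j k / a)"
  have sym: "\<forall>i<Suc k. \<forall>j<Suc k. X i j = X j i" using Suc.prems by (simp add: psd_iff)
  have a0: "0 \<le> a" using psd_diag_nonneg[OF Suc.prems] by (simp add: a_def)
  have az: "X i k = 0" if "a = 0" "i < k" for i
    using psd_zero_last[OF Suc.prems] that by (simp add: a_def)
  have "0 \<le> quad_form k Y w" for w
  proof -
    define b where "b = (\<Sum>i<k. w i * X i k)"
    \<comment> \<open>For \<open>a > 0\<close> this extension of \<open>w\<close> minimises the form
      of \<open>X\<close>, and the minimum is the form of the Schur complement at
      \<open>w\<close>.\<close>
    define z where "z = w(k := - b / a)"
    have b2: "b\<^sup>2 = (\<Sum>i<k. \<Sum>j<k. (w i * X i k) * (w j * X j k))"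
      unfolding b_def power2_eq_square by (simp add: sum_product)
    have "quad_form k Y w = quad_form k X w - b\<^sup>2 / a"
      unfolding quad_form_def b2 Y_def sum_divide_distrib sum_subtractf[symmetric]
      by (intro sum.cong refl) (simp add: algebra_simps)
    moreover have "quad_form (Suc k) X z = quad_form k X w - b\<^sup>2 / a"
    proof -
      have "quad_form k X z = quad_form k X w"
        by (rule quad_form_cong) (simp add: z_def)
      moreover have "(\<Sum>i<k. z i * X i k) = b"
        unfolding b_def by (intro sum.cong) (auto simp: z_def)
      moreover have "z k = - b / a" by (simp add: z_def)
      moreover have "2 * (- b / a) * b + (- b / a)\<^sup>2 * a = - b\<^sup>2 / a"
        by (cases "a = 0") (simp_all add: power2_eq_square field_simps)
      ultimately show ?thesis
        using quad_form_Suc[OF sym, of z] by (simp add: a_def[symmetric])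
    qed
    ultimately show ?thesis using Suc.prems by (metis psd_iff)
  qed
  then have "psd k Y" using sym by (auto simp: psd_iff Y_def mult.commute)
  then obtain g where g: "\<And>i j. i < k \<Longrightarrow> j < k \<Longrightarrow> Y i j = (\<Sum>l<k. g i l * g j l)"
    using Suc.IH by blast
  \<comment> \<open>Column \<open>k\<close> reproduces the term \<open>X i k * X j k / a\<close>
    that was subtracted in \<open>Y\<close>; row \<open>k\<close> vanishes in all other
    columns.\<close>
  define h where "h = (\<lambda>i l. if l = k then (if i = k then sqrt a else X i k / sqrt a)
                             else if i = k then 0 else g i l)"
  have "X i j = (\<Sum>l<Suc k. h i l * h j l)" if ij: "i < Suc k" "j < Suc k" for i j
  proof -
    have hk: "(\<Sum>l<k. h i l * h j l) = (if i = k \<or> j = k then 0 else (\<Sum>l<k. g i l * g j l))"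
      by (auto simp: h_def intro!: sum.cong sum.neutral)
    show ?thesis
    proof (cases "i = k \<or> j = k")
      case True
      have "h i k * h j k = X i j"
      proof -
        have *: "h k k * h l k = X l k" "h l k * h k k = X l k" if "l < Suc k" for l
          using that a0 az[of l] by (cases "a = 0"; auto simp: h_def a_def less_Suc_eq)+
        have "X k j = X j k" using sym ij by blast
        then show ?thesis using True * ij by auto
      qed
      then show ?thesis using True hk by simp
    next
      case False
      then have lt: "i < k" "j < k" using ij by auto
      have "h i k * h j k = X i k * X j k / a"
        using False a0 by (simp add: h_def)
      then show ?thesis using False hk g[OF lt] by (simp add: Y_def)
    qed
  qed
  then show ?case by blast
qed

lemma mat_inner_gram:
  assumes "\<And>i j. i < k \<Longrightarrow> j < k \<Longrightarrow> X i j = (\<Sum>l<d. g i l * g j l)"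
  shows "mat_inner k k Y X = (\<Sum>l<d. quad_form k Y (\<lambda>i. g i l))"
proof -
  have "mat_inner k k Y X = (\<Sum>i<k. \<Sum>j<k. \<Sum>l<d. g i l * Y i j * g j l)"
    unfolding mat_inner_def by (intro sum.cong refl) (simp add: assms sum_distrib_left mult_ac)
  also have "\<dots> = (\<Sum>i<k. \<Sum>l<d. \<Sum>j<k. g i l * Y i j * g j l)"
    by (intro sum.cong refl sum.swap)
  also have "\<dots> = (\<Sum>l<d. quad_form k Y (\<lambda>i. g i l))"
    unfolding quad_form_def by (rule sum.swap)
  finally show ?thesis .
qed

text \<open>A Gram factorisation of \<open>X\<close> turns the inner product into a sum of values of
  the form of \<open>Y\<close>.\<close>

lemma mat_inner_psd_nonneg:
  assumes "psd k X" "psd k Y"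
  shows "0 \<le> mat_inner k k Y X"
proof -
  obtain g where "\<forall>i<k. \<forall>j<k. X i j = (\<Sum>l<k. g i l * g j l)"
    using psd_gram[OF assms(1)] by blast
  then have "mat_inner k k Y X = (\<Sum>l<k. quad_form k Y (\<lambda>i. g i l))"
    by (intro mat_inner_gram) simp
  then show ?thesis using assms(2) by (simp add: psd_iff sum_nonneg)
qed

subsection \<open>Grothendieck's inequality\<close>

text \<open>A sign pattern is encoded as the set \<open>S\<close> of its positive positions, so that
  expectations become sums over \<open>Pow {..<d}\<close>, larger by the factor
  \<open>2 ^ d\<close>.\<close>

definition rademacher :: "nat \<Rightarrow> (nat \<Rightarrow> real) \<Rightarrow> nat set \<Rightarrow> real" where
  "rademacher d u S = (\<Sum>k<d. (if k \<in> S then u k else - u k))"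

lemma sum_Pow_lessThan_Suc:
  fixes f :: "nat set \<Rightarrow> real"
  shows "(\<Sum>S\<in>Pow {..<Suc d}. f S) = (\<Sum>S\<in>Pow {..<d}. f S + f (insert d S))"
proof -
  have "inj_on (insert d) (Pow {..<d})"
    by (auto simp: inj_on_def)
  moreover have "Pow {..<d} \<inter> insert d ` Pow {..<d} = {}" by auto
  ultimately show ?thesis
    by (simp add: lessThan_Suc Pow_insert sum.union_disjoint sum.reindex sum.distrib)
qed

lemma rademacher_Suc:
  assumes "S \<in> Pow {..<d}"
  shows "rademacher (Suc d) u S = rademacher d u S - u d"
    and "rademacher (Suc d) u (insert d S) = rademacher d u S + u d"
proof -
  have "d \<notin> S" using assms by auto
  then show "rademacher (Suc d) u S = rademacher d u S - u d"
    by (simp add: rademacher_def)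
  have "(\<Sum>k<d. (if k \<in> insert d S then u k else - u k)) = (\<Sum>k<d. (if k \<in> S then u k else - u k))"
    by (intro sum.cong) auto
  then show "rademacher (Suc d) u (insert d S) = rademacher d u S + u d"
    by (simp add: rademacher_def)
qed

text \<open>Independent signs are uncorrelated: the mixed terms of \<open>S\<close> and
  \<open>insert d S\<close> cancel. Inner products thus become averages of products of
  scalars.\<close>

lemma rademacher_second_moment:
  "(\<Sum>S\<in>Pow {..<d}. rademacher d u S * rademacher d v S) = 2 ^ d * (\<Sum>k<d. u k * v k)"
proof (induction d)
  case 0
  then show ?case by (simp add: rademacher_def)
next
  case (Suc d)
  have "(\<Sum>S\<in>Pow {..<Suc d}. rademacher (Suc d) u S * rademacher (Suc d) v S)
     = (\<Sum>S\<in>Pow {..<d}. 2 * (rademacher d u S * rademacher d v S) + 2 * (u d * v d))"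
    unfolding sum_Pow_lessThan_Suc
    by (intro sum.cong refl) (simp add: rademacher_Suc algebra_simps)
  also have "\<dots> = 2 ^ Suc d * (\<Sum>k<Suc d. u k * v k)"
    by (simp add: sum.distrib sum_distrib_left[symmetric] Suc.IH card_Pow algebra_simps)
  finally show ?case .
qed

text \<open>Averaging over the new sign turns \<open>r ^ 4\<close> into
  \<open>r ^ 4 + 6 * a\<^sup>2 * r\<^sup>2 + a ^ 4\<close> with \<open>a = u d\<close>, and the
  expansion of \<open>3 * (q + a\<^sup>2)\<^sup>2\<close> has room for all three terms.\<close>

lemma rademacher_fourth_moment:
  "(\<Sum>S\<in>Pow {..<d}. rademacher d u S ^ 4) \<le> 3 * 2 ^ d * (\<Sum>k<d. (u k)\<^sup>2)\<^sup>2"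
proof (induction d)
  case 0
  then show ?case by (simp add: rademacher_def)
next
  case (Suc d)
  define q where "q = (\<Sum>k<d. (u k)\<^sup>2)"
  have "(\<Sum>S\<in>Pow {..<Suc d}. rademacher (Suc d) u S ^ 4)
     = (\<Sum>S\<in>Pow {..<d}. 2 * rademacher d u S ^ 4
         + 12 * (u d)\<^sup>2 * (rademacher d u S * rademacher d u S) + 2 * u d ^ 4)"
    unfolding sum_Pow_lessThan_Suc
    by (intro sum.cong refl) (simp add: rademacher_Suc power4_eq_xxxx power2_eq_square algebra_simps)
  also have "\<dots> = 2 * (\<Sum>S\<in>Pow {..<d}. rademacher d u S ^ 4)
      + 12 * (u d)\<^sup>2 * (2 ^ d * q) + 2 * 2 ^ d * u d ^ 4"
    by (simp add: sum.distrib sum_distrib_left[symmetric] rademacher_second_moment card_Pow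
        q_def power2_eq_square)
  also have "\<dots> \<le> 2 * (3 * 2 ^ d * q\<^sup>2) + 12 * (u d)\<^sup>2 * (2 ^ d * q) + 6 * 2 ^ d * u d ^ 4"
  proof -
    have "2 * 2 ^ d * u d ^ 4 \<le> 6 * 2 ^ d * u d ^ 4" by simp
    then show ?thesis using Suc.IH unfolding q_def by linarith
  qed
  also have "\<dots> = 3 * 2 ^ Suc d * (\<Sum>k<Suc d. (u k)\<^sup>2)\<^sup>2"
    by (simp add: q_def[symmetric] power2_sum) (simp add: power2_eq_square power4_eq_xxxx algebra_simps)
  finally show ?case .
qed

section \<open>Truncation and absorption\<close>

definition clamp1 :: "real \<Rightarrow> real" where
  "clamp1 x = max (-1) (min 1 x)"

lemma abs_clamp1_le: "\<bar>clamp1 x\<bar> \<le> 1"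
  by (simp add: clamp1_def)

lemma clamp1_sq_le: "(clamp1 x)\<^sup>2 \<le> x\<^sup>2"
  by (rule power2_le_iff_abs_le[THEN iffD2, of "\<bar>x\<bar>", simplified]) (auto simp: clamp1_def)

text \<open>The excess beyond 1 is at most \<open>\<bar>x\<bar> - 1 \<le> x\<^sup>2 / 4\<close>.
  Squared, it is controlled by the fourth moment, which makes tails small in mean square.\<close>

lemma clamp1_tail_sq_le: "(x - clamp1 x)\<^sup>2 \<le> x ^ 4 / 16"
proof -
  have "0 \<le> (x / 2 - 1)\<^sup>2" "0 \<le> (x / 2 + 1)\<^sup>2" by simp_all
  then have "\<bar>x - clamp1 x\<bar> \<le> x\<^sup>2 / 4"
    by (auto simp: clamp1_def power2_eq_square algebra_simps max_def min_def abs_if)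
  then have "\<bar>x - clamp1 x\<bar>\<^sup>2 \<le> (x\<^sup>2 / 4)\<^sup>2" by (intro power_mono) auto
  then show ?thesis by (simp add: power_divide)
qed

text \<open>The index type is free because vectors are indexed both by coordinates and by sign
  patterns.\<close>

definition gram_form :: "nat \<Rightarrow> nat \<Rightarrow> (nat \<Rightarrow> nat \<Rightarrow> real) \<Rightarrow> 'i set \<Rightarrow> (nat \<Rightarrow> 'i \<Rightarrow> real)
    \<Rightarrow> (nat \<Rightarrow> 'i \<Rightarrow> real) \<Rightarrow> real" where
  "gram_form m n A I u v = (\<Sum>i<m. \<Sum>j<n. A i j * (\<Sum>k\<in>I. u i k * v j k))"

lemma gram_form_eq_sum_bilin:
  "gram_form m n A I u v = (\<Sum>k\<in>I. bilin m n (\<lambda>i. u i k) A (\<lambda>j. v j k))"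
proof -
  have "gram_form m n A I u v = (\<Sum>i<m. \<Sum>k\<in>I. \<Sum>j<n. u i k * A i j * v j k)"
    unfolding gram_form_def sum_distrib_left
    by (intro sum.cong refl, subst sum.swap) (simp add: mult_ac)
  also have "\<dots> = (\<Sum>k\<in>I. bilin m n (\<lambda>i. u i k) A (\<lambda>j. v j k))"
    unfolding bilin_def by (rule sum.swap)
  finally show ?thesis .
qed

text \<open>The supremum ranges over all dimensions, so it also bounds the form on the vectors of
  length \<open>2 ^ d\<close> obtained from truncated Rademacher sums.\<close>

definition gram_sup :: "nat \<Rightarrow> nat \<Rightarrow> (nat \<Rightarrow> nat \<Rightarrow> real) \<Rightarrow> real" where
  "gram_sup m n A = Sup {gram_form m n A {..<d} u v | (d::nat) u v.
     (\<forall>i<m. (\<Sum>k<d. (u i k)\<^sup>2) \<le> 1) \<and> (\<forall>j<n. (\<Sum>k<d. (v j k)\<^sup>2) \<le> 1)}"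

text \<open>A crude Cauchy-Schwarz bound that depends on \<open>A\<close>. It makes
  \<open>gram_sup\<close> a genuine supremum, without which absorbing a multiple of it would prove
  nothing.\<close>

lemma gram_form_le_abs_sum:
  assumes "\<forall>i<m. (\<Sum>k\<in>I. (u i k)\<^sup>2) \<le> 1" "\<forall>j<n. (\<Sum>k\<in>I. (v j k)\<^sup>2) \<le> 1"
  shows "gram_form m n A I u v \<le> (\<Sum>i<m. \<Sum>j<n. \<bar>A i j\<bar>)"
  unfolding gram_form_def
proof (intro sum_mono)
  fix i j assume "i \<in> {..<m}" "j \<in> {..<n}"
  then have "(\<Sum>k\<in>I. (u i k)\<^sup>2) * (\<Sum>k\<in>I. (v j k)\<^sup>2) \<le> 1 * 1"
    using assms by (intro mult_mono sum_nonneg) auto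
  then have "(\<Sum>k\<in>I. u i k * v j k)\<^sup>2 \<le> 1"
    using Cauchy_Schwarz_ineq_sum[of "u i" "v j" I] by simp
  then have "\<bar>\<Sum>k\<in>I. u i k * v j k\<bar> \<le> 1" by (simp add: abs_square_le_1)
  then have "\<bar>A i j * (\<Sum>k\<in>I. u i k * v j k)\<bar> \<le> \<bar>A i j\<bar>"
    by (simp add: abs_mult mult_left_le)
  then show "A i j * (\<Sum>k\<in>I. u i k * v j k) \<le> \<bar>A i j\<bar>" by linarith
qed

lemma bdd_above_gram:
  "bdd_above {gram_form m n A {..<d} u v | (d::nat) u v.
     (\<forall>i<m. (\<Sum>k<d. (u i k)\<^sup>2) \<le> 1) \<and> (\<forall>j<n. (\<Sum>k<d. (v j k)\<^sup>2) \<le> 1)}"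
  by (rule bdd_aboveI[of _ "\<Sum>i<m. \<Sum>j<n. \<bar>A i j\<bar>"]) (use gram_form_le_abs_sum in blast)

text \<open>Homogeneity reduces to vectors in the unit ball, and an enumeration of \<open>I\<close>
  replaces it by an initial segment.\<close>

lemma gram_form_le_gram_sup:
  fixes I :: "'i set"
  assumes "finite I" and a: "a > 0" and b: "b > 0"
    and u: "\<And>i. i < m \<Longrightarrow> (\<Sum>k\<in>I. (u i k)\<^sup>2) \<le> a\<^sup>2"
    and v: "\<And>j. j < n \<Longrightarrow> (\<Sum>k\<in>I. (v j k)\<^sup>2) \<le> b\<^sup>2"
  shows "gram_form m n A I u v \<le> a * b * gram_sup m n A"
proof -
  obtain h where h: "bij_betw h {..<card I} I"
    using ex_bij_betw_nat_finite[OF \<open>finite I\<close>] by (auto simp: lessThan_atLeast0)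
  define u' where "u' = (\<lambda>i k. u i (h k) / a)"
  define v' where "v' = (\<lambda>i k. v i (h k) / b)"
  have re: "(\<Sum>k<card I. f (h k)) = (\<Sum>k\<in>I. f k)" for f :: "'i \<Rightarrow> real"
    by (rule sum.reindex_bij_betw[OF h])
  have "(\<Sum>k<card I. (u' i k)\<^sup>2) \<le> 1" if "i < m" for i
    using u[OF that] a re[of "\<lambda>k. (u i k / a)\<^sup>2"]
    by (simp add: u'_def power_divide sum_divide_distrib[symmetric])
  moreover have "(\<Sum>k<card I. (v' j k)\<^sup>2) \<le> 1" if "j < n" for j
    using v[OF that] b re[of "\<lambda>k. (v j k / b)\<^sup>2"]
    by (simp add: v'_def power_divide sum_divide_distrib[symmetric])
  ultimately have "gram_form m n A {..<card I} u' v' \<le> gram_sup m n A"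
    unfolding gram_sup_def by (intro cSup_upper bdd_above_gram) blast
  moreover have "gram_form m n A {..<card I} u' v' = gram_form m n A I u v / (a * b)"
    using re[of "\<lambda>k. u i k * v j k" for i j]
    by (simp add: gram_form_def u'_def v'_def sum_divide_distrib[symmetric])
  ultimately show ?thesis using a b by (simp add: field_simps)
qed

text \<open>With \<open>r = T + R\<close>, truncation plus tail, \<open>r * r'\<close> splits into
  \<open>T * T' + T * R' + R * r'\<close>. Truncated values lie in the cube, so the first average is
  at most \<open>\<beta>\<close>. The other two are Gram forms with one short factor, each at most
  \<open>7 / 16 * gram_sup m n A\<close>. What matters is that the total coefficient stays below
  1.\<close>

lemma gram_form_le_rademacher:
  fixes d :: nat
  assumes \<beta>: "\<And>s t. (\<forall>i<m. \<bar>s i\<bar> \<le> 1) \<Longrightarrow> (\<forall>j<n. \<bar>t j\<bar> \<le> 1) \<Longrightarrow> bilin m n s A t \<le> \<beta>"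
    and u: "\<forall>i<m. (\<Sum>k<d. (u i k)\<^sup>2) \<le> 1" and v: "\<forall>j<n. (\<Sum>k<d. (v j k)\<^sup>2) \<le> 1"
  shows "gram_form m n A {..<d} u v \<le> \<beta> + 7 / 8 * gram_sup m n A"
proof -
  define I where "I = Pow {..<d}"
  define c where "c = sqrt (2 ^ d)"
  have c: "c > 0" "c\<^sup>2 = 2 ^ d" by (simp_all add: c_def)
  have fin: "finite I" "card I = 2 ^ d" by (simp_all add: I_def card_Pow)
  define r where "r = (\<lambda>w. rademacher d w)"
  define T where "T = (\<lambda>w S. clamp1 (r w S))"
  define R where "R = (\<lambda>w S. r w S - clamp1 (r w S))"
  have r2: "(\<Sum>S\<in>I. (r w S)\<^sup>2) \<le> c\<^sup>2" if "(\<Sum>k<d. (w k)\<^sup>2) \<le> 1" for w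
    using rademacher_second_moment[of d w w] that
    by (simp add: r_def I_def c(2) power2_eq_square[symmetric])
  have T2: "(\<Sum>S\<in>I. (T w S)\<^sup>2) \<le> c\<^sup>2" if "(\<Sum>k<d. (w k)\<^sup>2) \<le> 1" for w
    using r2[OF that] sum_mono[of I "\<lambda>S. (T w S)\<^sup>2" "\<lambda>S. (r w S)\<^sup>2"] clamp1_sq_le
    by (force simp: T_def)
  \<comment> \<open>The fourth moment gives the factor \<open>3 / 16\<close> for the square;
    \<open>7 / 16\<close> is a rational upper bound for \<open>sqrt 3 / 4\<close>.\<close>
  have R2: "(\<Sum>S\<in>I. (R w S)\<^sup>2) \<le> (7 / 16 * c)\<^sup>2" if w: "(\<Sum>k<d. (w k)\<^sup>2) \<le> 1" for w
  proof -
    have "(\<Sum>S\<in>I. (R w S)\<^sup>2) \<le> (\<Sum>S\<in>I. r w S ^ 4 / 16)"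
      unfolding R_def by (intro sum_mono clamp1_tail_sq_le)
    also have "\<dots> \<le> 3 * 2 ^ d * (\<Sum>k<d. (w k)\<^sup>2)\<^sup>2 / 16"
      using rademacher_fourth_moment[of d w] by (simp add: r_def I_def sum_divide_distrib[symmetric])
    also have "\<dots> \<le> 3 * 2 ^ d * 1 / 16"
      using w by (intro divide_right_mono mult_left_mono) (simp_all add: power_le_one sum_nonneg)
    also have "\<dots> \<le> (7 / 16 * c)\<^sup>2"
      by (simp only: power_mult_distrib c(2)) (simp add: power_divide)
    finally show ?thesis .
  qed
  have "2 ^ d * gram_form m n A {..<d} u v = gram_form m n A I (\<lambda>i. r (u i)) (\<lambda>j. r (v j))"
    by (simp add: gram_form_def r_def I_def rademacher_second_moment sum_distrib_left mult_ac)
  moreover have "gram_form m n A I (\<lambda>i. r (u i)) (\<lambda>j. r (v j))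
      = gram_form m n A I (\<lambda>i. T (u i)) (\<lambda>j. T (v j))
      + gram_form m n A I (\<lambda>i. T (u i)) (\<lambda>j. R (v j))
      + gram_form m n A I (\<lambda>i. R (u i)) (\<lambda>j. r (v j))"
  proof -
    have split: "(\<Sum>S\<in>I. r (u i) S * r (v j) S) = (\<Sum>S\<in>I. T (u i) S * T (v j) S)
        + (\<Sum>S\<in>I. T (u i) S * R (v j) S) + (\<Sum>S\<in>I. R (u i) S * r (v j) S)" for i j
      unfolding sum.distrib[symmetric] by (intro sum.cong refl) (simp add: T_def R_def algebra_simps)
    show ?thesis
      unfolding gram_form_def split by (simp add: sum.distrib distrib_left)
  qed
  moreover have "gram_form m n A I (\<lambda>i. T (u i)) (\<lambda>j. T (v j)) \<le> 2 ^ d * \<beta>"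
  proof -
    have "bilin m n (\<lambda>i. T (u i) S) A (\<lambda>j. T (v j) S) \<le> \<beta>" for S
      by (intro \<beta>) (simp_all add: T_def abs_clamp1_le)
    then show ?thesis
      using sum_bounded_above[of I "\<lambda>S. bilin m n (\<lambda>i. T (u i) S) A (\<lambda>j. T (v j) S)" \<beta>] fin
      by (simp add: gram_form_eq_sum_bilin)
  qed
  moreover have "gram_form m n A I (\<lambda>i. T (u i)) (\<lambda>j. R (v j)) \<le> c * (7 / 16 * c) * gram_sup m n A"
    using c u v fin by (intro gram_form_le_gram_sup T2 R2) auto
  moreover have "gram_form m n A I (\<lambda>i. R (u i)) (\<lambda>j. r (v j)) \<le> (7 / 16 * c) * c * gram_sup m n A"
    using c u v fin by (intro gram_form_le_gram_sup r2 R2) auto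
  moreover have "2 ^ d * \<beta> + c * (7 / 16 * c) * gram_sup m n A + (7 / 16 * c) * c * gram_sup m n A
      = 2 ^ d * (\<beta> + 7 / 8 * gram_sup m n A)"
    by (simp add: c(2)[symmetric] power2_eq_square algebra_simps)
  ultimately have "2 ^ d * gram_form m n A {..<d} u v \<le> 2 ^ d * (\<beta> + 7 / 8 * gram_sup m n A)"
    by linarith
  then show ?thesis by simp
qed

text \<open>Taking the supremum in the preceding bound gives
  \<open>gram_sup m n A \<le> \<beta> + 7 / 8 * gram_sup m n A\<close>, hence
  \<open>gram_sup m n A \<le> 8 * \<beta>\<close>.\<close>

lemma gram_form_le_8:
  fixes d :: nat
  assumes \<beta>: "\<And>s t. (\<forall>i<m. \<bar>s i\<bar> \<le> 1) \<Longrightarrow> (\<forall>j<n. \<bar>t j\<bar> \<le> 1) \<Longrightarrow> bilin m n s A t \<le> \<beta>"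
    and u: "\<forall>i<m. (\<Sum>k<d. (u i k)\<^sup>2) \<le> 1" and v: "\<forall>j<n. (\<Sum>k<d. (v j k)\<^sup>2) \<le> 1"
  shows "gram_form m n A {..<d} u v \<le> 8 * \<beta>"
proof -
  define b where "b = \<beta> + 7 / 8 * gram_sup m n A"
  have le: "gram_form m n A {..<d} u v \<le> b"
    if "\<forall>i<m. (\<Sum>k<d. (u i k)\<^sup>2) \<le> 1" "\<forall>j<n. (\<Sum>k<d. (v j k)\<^sup>2) \<le> 1" for d :: nat and u v
    unfolding b_def using \<beta> that by (rule gram_form_le_rademacher)
  have "gram_sup m n A \<le> b"
    unfolding gram_sup_def using u v by (intro cSup_least) (blast intro: le)+
  then show ?thesis using le[OF u v] by (simp add: b_def)
qed

section \<open>Sign vectors and the Grothendieck constant\<close>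

definition sign_sup :: "nat \<Rightarrow> nat \<Rightarrow> (nat \<Rightarrow> nat \<Rightarrow> real) \<Rightarrow> real" where
  "sign_sup m n A = Sup {bilin m n s A t | s t. (\<forall>i<m. \<bar>s i\<bar> = 1) \<and> (\<forall>j<n. \<bar>t j\<bar> = 1)}"

lemma bilin_le_abs_sum:
  assumes "\<forall>i<m. \<bar>s i\<bar> \<le> 1" "\<forall>j<n. \<bar>t j\<bar> \<le> 1"
  shows "bilin m n s A t \<le> (\<Sum>i<m. \<Sum>j<n. \<bar>A i j\<bar>)"
  unfolding bilin_def
proof (intro sum_mono)
  fix i j assume "i \<in> {..<m}" "j \<in> {..<n}"
  then have "\<bar>s i\<bar> * \<bar>t j\<bar> \<le> 1 * 1"
    using assms by (intro mult_mono) auto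
  then have "\<bar>A i j\<bar> * (\<bar>s i\<bar> * \<bar>t j\<bar>) \<le> \<bar>A i j\<bar>"
    by (simp add: mult_left_le)
  then have "\<bar>s i * A i j * t j\<bar> \<le> \<bar>A i j\<bar>"
    by (simp add: abs_mult mult_ac)
  then show "s i * A i j * t j \<le> \<bar>A i j\<bar>" by linarith
qed

lemma bilin_le_sign_sup:
  assumes "\<forall>i<m. \<bar>s i\<bar> = 1" "\<forall>j<n. \<bar>t j\<bar> = 1"
  shows "bilin m n s A t \<le> sign_sup m n A"
  unfolding sign_sup_def
proof (rule cSup_upper)
  show "bdd_above {bilin m n s A t | s t. (\<forall>i<m. \<bar>s i\<bar> = 1) \<and> (\<forall>j<n. \<bar>t j\<bar> = 1)}"
    by (rule bdd_aboveI[of _ "\<Sum>i<m. \<Sum>j<n. \<bar>A i j\<bar>"]) (auto intro!: bilin_le_abs_sum)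
qed (use assms in blast)

lemma bilin_eq_row: "bilin m n s A t = (\<Sum>i<m. s i * (\<Sum>j<n. A i j * t j))"
  by (simp add: bilin_def sum_distrib_left mult_ac)

lemma bilin_eq_col: "bilin m n s A t = (\<Sum>j<n. t j * (\<Sum>i<m. s i * A i j))"
  unfolding bilin_def by (subst sum.swap) (simp add: sum_distrib_left mult_ac)

lemma mult_le_signed:
  fixes x c :: real
  assumes "\<bar>x\<bar> \<le> 1"
  shows "x * c \<le> (if c \<ge> 0 then 1 else -1) * c"
  using assms mult_right_mono[of x 1 c] mult_right_mono_neg[of "-1" x c] by auto

text \<open>The form is linear in each argument, so first \<open>s\<close> and then \<open>t\<close>
  moves to a vertex of the cube without decrease. The signs in \<open>t'\<close> belong to the
  coefficients that arise after \<open>s\<close> has become \<open>s'\<close>.\<close>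

lemma bilin_cube_le_sign_sup:
  assumes s: "\<forall>i<m. \<bar>s i\<bar> \<le> 1" and t: "\<forall>j<n. \<bar>t j\<bar> \<le> 1"
  shows "bilin m n s A t \<le> sign_sup m n A"
proof -
  define s' where "s' = (\<lambda>i. if (\<Sum>j<n. A i j * t j) \<ge> 0 then 1 else -1 :: real)"
  define t' where "t' = (\<lambda>j. if (\<Sum>i<m. s' i * A i j) \<ge> 0 then 1 else -1 :: real)"
  have "bilin m n s A t \<le> bilin m n s' A t"
    unfolding bilin_eq_row s'_def using s by (intro sum_mono mult_le_signed) auto
  also have "\<dots> \<le> bilin m n s' A t'"
    unfolding bilin_eq_col t'_def using t by (intro sum_mono mult_le_signed) auto
  also have "\<dots> \<le> sign_sup m n A"
    by (rule bilin_le_sign_sup) (auto simp: s'_def t'_def)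
  finally show ?thesis .
qed

lemma sign_sup_nonneg: "0 \<le> sign_sup m n A"
  using bilin_cube_le_sign_sup[of m "\<lambda>_. 0" n "\<lambda>_. 0" A] by (simp add: bilin_def)

definition grothendieck_bounds :: "real set" where
  "grothendieck_bounds = {K. \<forall>(m::nat) (n::nat) A (d::nat) u v.
     (\<forall>i<m. (\<Sum>k<d. (u i k)\<^sup>2) = 1) \<and> (\<forall>j<n. (\<Sum>k<d. (v j k)\<^sup>2) = 1) \<longrightarrow>
     gram_form m n A {..<d} u v \<le> K * sign_sup m n A}"

lemma grothendieck_constant_eq: "grothendieck_constant = Inf grothendieck_bounds"
  unfolding grothendieck_constant_def grothendieck_bounds_def sign_sup_def gram_form_def ..

text \<open>Ensures that the infimum defining the constant ranges over a nonempty set; any finite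
  value would serve.\<close>

lemma grothendieck_bounds_8: "8 \<in> grothendieck_bounds"
  unfolding grothendieck_bounds_def
  by (intro CollectI allI impI gram_form_le_8 bilin_cube_le_sign_sup) simp_all

text \<open>Forced by the 1 x 1 matrix with entry 1. It bounds the infimum from below and later
  permits division by the constant.\<close>

lemma grothendieck_bounds_ge_1:
  assumes "K \<in> grothendieck_bounds"
  shows "1 \<le> K"
proof -
  define e where "e = (\<lambda>(_::nat) (_::nat). 1 :: real)"
  define \<sigma> where "\<sigma> = sign_sup (Suc 0) (Suc 0) e"
  have "gram_form (Suc 0) (Suc 0) e {..<Suc 0} e e \<le> K * \<sigma>"
    using assms[unfolded grothendieck_bounds_def, THEN CollectD, THEN spec[of _ "Suc 0"],
        THEN spec[of _ "Suc 0"], THEN spec[of _ e], THEN spec[of _ "Suc 0"], THEN spec[of _ e],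
        THEN spec[of _ e]]
    unfolding \<sigma>_def[symmetric] by (simp add: e_def)
  then have le: "1 \<le> K * \<sigma>" by (simp add: gram_form_def e_def)
  have "\<sigma> \<le> 1"
    unfolding \<sigma>_def sign_sup_def
  proof (rule cSup_least)
    show "{bilin (Suc 0) (Suc 0) s e t | s t. (\<forall>i<Suc 0. \<bar>s i\<bar> = 1) \<and> (\<forall>j<Suc 0. \<bar>t j\<bar> = 1)} \<noteq> {}"
      by (auto intro!: exI[of _ "\<lambda>_. 1"])
  next
    fix x assume "x \<in> {bilin (Suc 0) (Suc 0) s e t | s t.
      (\<forall>i<Suc 0. \<bar>s i\<bar> = 1) \<and> (\<forall>j<Suc 0. \<bar>t j\<bar> = 1)}"
    then obtain s t where "x = bilin (Suc 0) (Suc 0) s e t" "\<forall>i<Suc 0. \<bar>s i\<bar> = 1" "\<forall>j<Suc 0. \<bar>t j\<bar> = 1"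
      by blast
    then show "x \<le> 1"
      using bilin_le_abs_sum[of "Suc 0" s "Suc 0" t e] by (simp add: e_def)
  qed
  moreover have "0 \<le> \<sigma>" unfolding \<sigma>_def by (rule sign_sup_nonneg)
  moreover have "0 \<le> K"
    using le mult_nonpos_nonneg[OF _ \<open>0 \<le> \<sigma>\<close>, of K] by linarith
  ultimately have "K * \<sigma> \<le> K * 1" by (intro mult_left_mono)
  then show ?thesis using le by simp
qed

lemma grothendieck_constant_ge_1: "1 \<le> grothendieck_constant"
  unfolding grothendieck_constant_eq
  using grothendieck_bounds_8 grothendieck_bounds_ge_1 by (intro cInf_greatest) auto

text \<open>The infimum is itself a valid constant: divide by \<open>sign_sup\<close> and compare
  with every member of the set. If \<open>sign_sup\<close> vanishes, all constants give the same
  right-hand side and 8 suffices.\<close>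

lemma grothendieck_inequality:
  fixes d :: nat
  assumes uv: "\<forall>i<m. (\<Sum>k<d. (u i k)\<^sup>2) = 1" "\<forall>j<n. (\<Sum>k<d. (v j k)\<^sup>2) = 1"
  shows "gram_form m n A {..<d} u v \<le> grothendieck_constant * sign_sup m n A"
proof (cases "sign_sup m n A = 0")
  case True
  have "gram_form m n A {..<d} u v \<le> 8 * sign_sup m n A"
    using grothendieck_bounds_8 uv unfolding grothendieck_bounds_def by blast
  then show ?thesis using True by simp
next
  case False
  then have pos: "sign_sup m n A > 0" using sign_sup_nonneg[of m n A] by linarith
  have "gram_form m n A {..<d} u v / sign_sup m n A \<le> grothendieck_constant"
    unfolding grothendieck_constant_eq
  proof (rule cInf_greatest)
    fix K assume "K \<in> grothendieck_bounds"
    then have "gram_form m n A {..<d} u v \<le> K * sign_sup m n A"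
      using uv unfolding grothendieck_bounds_def by blast
    then show "gram_form m n A {..<d} u v / sign_sup m n A \<le> K"
      using pos by (simp add: field_simps)
  qed (use grothendieck_bounds_8 in auto)
  then show ?thesis using pos by (simp add: field_simps)
qed

subsection \<open>Spectral norm and its semidefinite relaxation\<close>

lemma powr_sum_entry_le_1:
  fixes q :: real
  assumes "q > 0" "finite I" "(\<Sum>i\<in>I. \<bar>x i\<bar> powr q) \<le> 1" "i \<in> I"
  shows "\<bar>x i :: real\<bar> \<le> 1"
proof (rule ccontr)
  assume "\<not> \<bar>x i\<bar> \<le> 1"
  then have "1 < \<bar>x i\<bar> powr q" using assms(1) by (intro gr_one_powr) auto
  also have "\<dots> \<le> (\<Sum>i\<in>I. \<bar>x i\<bar> powr q)" using assms by (intro member_le_sum) auto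
  finally show False using assms(3) by simp
qed

lemma vec_pnorm_eq_1_iff:
  assumes "p > 0"
  shows "vec_pnorm p k x = 1 \<longleftrightarrow> (\<Sum>i<k. \<bar>x i\<bar> powr p) = 1"
proof
  assume "vec_pnorm p k x = 1"
  then have "((\<Sum>i<k. \<bar>x i\<bar> powr p) powr (1 / p)) powr p = 1"
    by (simp add: vec_pnorm_def)
  then show "(\<Sum>i<k. \<bar>x i\<bar> powr p) = 1"
    using assms by (simp add: powr_powr sum_nonneg)
qed (simp add: vec_pnorm_def)

lemma vec_pnorm_unit:
  assumes "a < k" "p > 0"
  shows "vec_pnorm p k (\<lambda>i. if i = a then 1 else 0) = 1"
proof -
  have "(\<Sum>i<k. \<bar>if i = a then 1 else 0 :: real\<bar> powr p) = (\<Sum>i<k. if i = a then 1 else 0)"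
    by (intro sum.cong refl) auto
  then show ?thesis using assms by (simp add: vec_pnorm_eq_1_iff)
qed

text \<open>The spectral norm is a supremum over spheres, while the rescaled vectors below lie in
  balls. The zero vector is 0 times a coordinate vector, hence \<open>k > 0\<close>.\<close>

lemma powr_ball_scale:
  assumes p: "p > 0" and k: "k > 0" and x: "(\<Sum>i<k. \<bar>x i\<bar> powr p) \<le> 1"
  obtains c z where "0 \<le> c" "c \<le> 1" "vec_pnorm p k z = 1" "\<And>i. i < k \<Longrightarrow> x i = c * z i"
proof (cases "(\<Sum>i<k. \<bar>x i\<bar> powr p) = 0")
  case True
  then have "x i = 0" if "i < k" for i
    using that by (simp add: sum_nonneg_eq_0_iff)
  then show ?thesis
    using that[of 0 "\<lambda>i. if i = 0 then 1 else 0"] vec_pnorm_unit[OF k p] by simp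
next
  case False
  define c where "c = (\<Sum>i<k. \<bar>x i\<bar> powr p) powr (1 / p)"
  have pos: "(\<Sum>i<k. \<bar>x i\<bar> powr p) > 0"
    using False by (simp add: sum_nonneg order_less_le)
  have c: "c > 0" "c powr p = (\<Sum>i<k. \<bar>x i\<bar> powr p)"
    using pos p by (simp_all add: c_def powr_powr)
  have "c \<le> 1" unfolding c_def using x pos p by (intro powr_le1) auto
  moreover have "(\<Sum>i<k. \<bar>x i / c\<bar> powr p) = 1"
    using c pos by (simp add: powr_divide sum_divide_distrib[symmetric])
  ultimately show ?thesis
    using that[of c "\<lambda>i. x i / c"] c p by (simp add: vec_pnorm_eq_1_iff)
qed

lemma bilin_cong:
  assumes "\<And>i. i < m \<Longrightarrow> x i = x' i" "\<And>j. j < n \<Longrightarrow> y j = y' j"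
    "\<And>i j. i < m \<Longrightarrow> j < n \<Longrightarrow> A i j = A' i j"
  shows "bilin m n x A y = bilin m n x' A' y'"
  unfolding bilin_def using assms by (intro sum.cong refl) auto

lemma bilin_scale: "bilin m n (\<lambda>i. c * x i) A (\<lambda>j. d * y j) = c * d * bilin m n x A y"
  by (simp add: bilin_def sum_distrib_left mult_ac)

lemma vec_pnorm_1_abs_le_1:
  assumes "p > 0" "vec_pnorm p k x = 1"
  shows "\<forall>i<k. \<bar>x i\<bar> \<le> 1"
  using powr_sum_entry_le_1[of p "{..<k}" x] assms by (auto simp: vec_pnorm_eq_1_iff)

lemma bilin_le_spectral_unit:
  assumes "p > 0" "vec_pnorm p m x = 1" "vec_pnorm p n y = 1"
  shows "bilin m n x A y \<le> spectral_pnorm p m n A"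
  unfolding spectral_pnorm_def
proof (rule cSup_upper)
  show "bdd_above {bilin m n x A y | x y. vec_pnorm p m x = 1 \<and> vec_pnorm p n y = 1}"
    using vec_pnorm_1_abs_le_1[OF assms(1)]
    by (intro bdd_aboveI[of _ "\<Sum>i<m. \<Sum>j<n. \<bar>A i j\<bar>"]) (auto intro!: bilin_le_abs_sum)
qed (use assms in blast)

lemma spectral_pnorm_nonneg:
  assumes "p > 0" "m > 0" "n > 0"
  shows "0 \<le> spectral_pnorm p m n A"
proof -
  define e where "e = (\<lambda>i::nat. if i = 0 then 1 else 0 :: real)"
  have e: "vec_pnorm p k e = 1" if "k > 0" for k
    unfolding e_def using that assms(1) by (rule vec_pnorm_unit)
  have "vec_pnorm p m (\<lambda>i. - e i) = 1" using e[OF assms(2)] by (simp add: vec_pnorm_def)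
  then have "bilin m n (\<lambda>i. - e i) A e \<le> spectral_pnorm p m n A"
    using e assms by (intro bilin_le_spectral_unit)
  moreover have "bilin m n e A e \<le> spectral_pnorm p m n A"
    using e assms by (intro bilin_le_spectral_unit)
  moreover have "bilin m n (\<lambda>i. - e i) A e = - bilin m n e A e"
    using bilin_scale[of m n "-1" e A 1 e] by simp
  ultimately show ?thesis by linarith
qed

lemma bilin_le_spectral:
  assumes p: "p > 0" "m > 0" "n > 0"
    and x: "(\<Sum>i<m. \<bar>x i\<bar> powr p) \<le> 1" and y: "(\<Sum>j<n. \<bar>y j\<bar> powr p) \<le> 1"
  shows "bilin m n x A y \<le> spectral_pnorm p m n A"
proof -
  obtain c z where c: "0 \<le> c" "c \<le> 1" "vec_pnorm p m z = 1" "\<And>i. i < m \<Longrightarrow> x i = c * z i"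
    using powr_ball_scale[OF p(1,2) x] by blast
  obtain d w where d: "0 \<le> d" "d \<le> 1" "vec_pnorm p n w = 1" "\<And>i. i < n \<Longrightarrow> y i = d * w i"
    using powr_ball_scale[OF p(1,3) y] by blast
  have "bilin m n x A y = c * d * bilin m n z A w"
    using bilin_cong[of m x "\<lambda>i. c * z i" n y "\<lambda>j. d * w j" A A] c(4) d(4)
    by (simp add: bilin_scale)
  also have "\<dots> \<le> c * d * spectral_pnorm p m n A"
    using c d p by (intro mult_left_mono bilin_le_spectral_unit) auto
  also have "\<dots> \<le> 1 * spectral_pnorm p m n A"
    using c d spectral_pnorm_nonneg[OF p, of A] by (intro mult_right_mono mult_le_one) auto
  finally show ?thesis by simp
qed

lemma mat_inner_blk:
  "mat_inner (m + n) (m + n) (blk m n A) X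
     = (\<Sum>i<m. \<Sum>j<n. A i j / 2 * (X i (m + j) + X (m + j) i))"
proof -
  have "mat_inner (m + n) (m + n) (blk m n A) X
      = (\<Sum>i<m. \<Sum>j<n. A i j / 2 * X i (m + j)) + (\<Sum>j<n. \<Sum>i<m. A i j / 2 * X (m + j) i)"
    unfolding mat_inner_def sum_lessThan_add by (simp add: blk_def)
  also have "(\<Sum>j<n. \<Sum>i<m. A i j / 2 * X (m + j) i) = (\<Sum>i<m. \<Sum>j<n. A i j / 2 * X (m + j) i)"
    by (rule sum.swap)
  finally show ?thesis by (simp add: sum.distrib distrib_left)
qed

lemma mat_inner_blk_sym:
  assumes "\<And>i j. i < m + n \<Longrightarrow> j < m + n \<Longrightarrow> X i j = X j i"
  shows "mat_inner (m + n) (m + n) (blk m n A) X = (\<Sum>i<m. \<Sum>j<n. A i j * X i (m + j))"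
  unfolding mat_inner_blk
proof (intro sum.cong refl)
  fix i j assume "i \<in> {..<m}" "j \<in> {..<n}"
  then have "X (m + j) i = X i (m + j)" by (intro assms) auto
  then show "A i j / 2 * (X i (m + j) + X (m + j) i) = A i j * X i (m + j)" by simp
qed

section \<open>The semidefinite relaxation\<close>

definition pv_feasible :: "real \<Rightarrow> nat \<Rightarrow> nat \<Rightarrow> (nat \<Rightarrow> nat \<Rightarrow> real) \<Rightarrow> bool" where
  "pv_feasible p m n X \<longleftrightarrow> (\<Sum>i<m. \<bar>X i i\<bar> powr (p / 2)) \<le> 1 \<and>
     (\<Sum>i\<in>{m..<m+n}. \<bar>X i i\<bar> powr (p / 2)) \<le> 1 \<and> psd (m + n) X"

lemma pv_norm_eq:
  "pv_norm p m n A = Sup {mat_inner (m + n) (m + n) (blk m n A) X | X. pv_feasible p m n X}"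
  by (simp add: pv_norm_def pv_feasible_def)

text \<open>The diagonal of the rank-one matrix is \<open>z i * z i\<close>, which turns the
  exponent \<open>p / 2\<close> of the relaxation into the exponent \<open>p\<close> of the
  vectors.\<close>

lemma pv_feasible_rank_one:
  assumes "(\<Sum>i<m. \<bar>x i\<bar> powr p) \<le> 1" "(\<Sum>j<n. \<bar>y j\<bar> powr p) \<le> 1"
  defines "z \<equiv> \<lambda>i. if i < m then x i else y (i - m)"
  shows "pv_feasible p m n (\<lambda>i j. z i * z j)"
    and "mat_inner (m + n) (m + n) (blk m n A) (\<lambda>i j. z i * z j) = bilin m n x A y"
proof -
  have sq: "\<bar>z i * z i\<bar> powr (p / 2) = \<bar>z i\<bar> powr p" for i
  proof (cases "z i = 0")
    case False
    then have "\<bar>z i * z i\<bar> = \<bar>z i\<bar> powr 2"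
      by (simp add: powr_numeral power2_eq_square abs_mult)
    then show ?thesis by (simp only: powr_powr) simp
  qed simp
  have "quad_form (m + n) (\<lambda>i j. z i * z j) w = (\<Sum>i<m+n. w i * z i)\<^sup>2" for w
    by (simp add: quad_form_def power2_eq_square sum_product mult_ac)
  then have "psd (m + n) (\<lambda>i j. z i * z j)" by (simp add: psd_iff mult.commute)
  moreover have "(\<Sum>i<m. \<bar>z i\<bar> powr p) = (\<Sum>i<m. \<bar>x i\<bar> powr p)"
    by (intro sum.cong refl) (simp add: z_def)
  moreover have "(\<Sum>i\<in>{m..<m+n}. \<bar>z i\<bar> powr p) = (\<Sum>j<n. \<bar>y j\<bar> powr p)"
    unfolding sum_atLeastLessThan_add by (intro sum.cong refl) (simp add: z_def)
  ultimately show "pv_feasible p m n (\<lambda>i j. z i * z j)"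
    using assms(1,2) unfolding pv_feasible_def sq by simp
  show "mat_inner (m + n) (m + n) (blk m n A) (\<lambda>i j. z i * z j) = bilin m n x A y"
    by (subst mat_inner_blk_sym) (simp_all add: bilin_def z_def mult_ac)
qed

text \<open>Grothendieck's inequality asks for exact unit vectors. Where the diagonal entry is 0 the
  Gram vector is 0, and any unit vector may replace it since its weight \<open>sqrt (X i i)\<close>
  is 0.\<close>

lemma psd_gram_unit:
  assumes "psd k X"
  obtains g where "\<And>i. i < k \<Longrightarrow> (\<Sum>l<k. (g i l)\<^sup>2) = 1"
    "\<And>i j. i < k \<Longrightarrow> j < k \<Longrightarrow> X i j = sqrt (X i i) * sqrt (X j j) * (\<Sum>l<k. g i l * g j l)"
proof -
  obtain f where f: "\<And>i j. i < k \<Longrightarrow> j < k \<Longrightarrow> X i j = (\<Sum>l<k. f i l * f j l)"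
    using psd_gram[OF assms] by blast
  have diag: "X i i = (\<Sum>l<k. (f i l)\<^sup>2)" if "i < k" for i
    using f[OF that that] by (simp add: power2_eq_square)
  define g where "g = (\<lambda>i l. if X i i = 0 then (if l = 0 then 1 else 0) else f i l / sqrt (X i i))"
  have "(\<Sum>l<k. (g i l)\<^sup>2) = 1" if i: "i < k" for i
  proof (cases "X i i = 0")
    case True
    then have "(\<Sum>l<k. (g i l)\<^sup>2) = (\<Sum>l<k. if l = 0 then 1 else 0)"
      by (intro sum.cong refl) (simp add: g_def)
    then show ?thesis using i by simp
  next
    case False
    then show ?thesis
      using psd_diag_nonneg[OF assms i] diag[OF i]
      by (simp add: g_def power_divide sum_divide_distrib[symmetric])
  qed
  moreover have "f i l = sqrt (X i i) * g i l" if "i < k" "l < k" for i l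
  proof (cases "X i i = 0")
    case True
    then show ?thesis using diag[OF that(1)] that by (simp add: sum_nonneg_eq_0_iff)
  qed (simp add: g_def)
  then have "X i j = sqrt (X i i) * sqrt (X j j) * (\<Sum>l<k. g i l * g j l)" if "i < k" "j < k" for i j
    using f[OF that] that by (simp add: sum_distrib_left mult_ac)
  ultimately show ?thesis using that by blast
qed

lemma blk_le_grothendieck_spectral:
  assumes p: "p > 0" "m > 0" "n > 0" and X: "pv_feasible p m n X"
  shows "mat_inner (m + n) (m + n) (blk m n A) X \<le> grothendieck_constant * spectral_pnorm p m n A"
proof -
  have psd: "psd (m + n) X" using X by (simp add: pv_feasible_def)
  obtain g where g: "\<And>i. i < m + n \<Longrightarrow> (\<Sum>l<m + n. (g i l)\<^sup>2) = 1"
    "\<And>i j. i < m + n \<Longrightarrow> j < m + n \<Longrightarrow> X i j = sqrt (X i i) * sqrt (X j j) * (\<Sum>l<m + n. g i l * g j l)"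
    using psd_gram_unit[OF psd] by blast
  define r where "r = (\<lambda>i. sqrt (X i i))"
  have r: "r i powr p = \<bar>X i i\<bar> powr (p / 2)" if "i < m + n" for i
    using psd_diag_nonneg[OF psd that] by (simp add: r_def powr_half_sqrt[symmetric] powr_powr)
  have r0: "0 \<le> r i" if "i < m + n" for i
    using psd_diag_nonneg[OF psd that] by (simp add: r_def)
  define B where "B = (\<lambda>i j. r i * A i j * r (m + j))"
  have "mat_inner (m + n) (m + n) (blk m n A) X = (\<Sum>i<m. \<Sum>j<n. A i j * X i (m + j))"
    using psd by (intro mat_inner_blk_sym) (auto simp: psd_iff)
  also have "\<dots> = gram_form m n B {..<m + n} g (\<lambda>j. g (m + j))"
    unfolding gram_form_def by (intro sum.cong refl, subst g(2)) (auto simp: B_def r_def mult_ac)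
  also have "\<dots> \<le> grothendieck_constant * sign_sup m n B"
    by (intro grothendieck_inequality) (auto simp: g(1))
  also have "\<dots> \<le> grothendieck_constant * spectral_pnorm p m n A"
  proof (rule mult_left_mono)
    show "sign_sup m n B \<le> spectral_pnorm p m n A"
      unfolding sign_sup_def
    proof (rule cSup_least)
      show "{bilin m n s B t | s t. (\<forall>i<m. \<bar>s i\<bar> = 1) \<and> (\<forall>j<n. \<bar>t j\<bar> = 1)} \<noteq> {}"
        by (auto intro!: exI[of _ "\<lambda>_. 1"])
    next
      fix b assume "b \<in> {bilin m n s B t | s t. (\<forall>i<m. \<bar>s i\<bar> = 1) \<and> (\<forall>j<n. \<bar>t j\<bar> = 1)}"
      then obtain s t where b: "b = bilin m n s B t" and st: "\<forall>i<m. \<bar>s i\<bar> = 1" "\<forall>j<n. \<bar>t j\<bar> = 1"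
        by blast
      \<comment> \<open>The weights pass from the matrix to the sign vectors, which become points of
        the two \<open>p\<close>-balls because the weights have \<open>p\<close>-th powers
        \<open>\<bar>X i i\<bar> powr (p / 2)\<close>.\<close>
      have "b = bilin m n (\<lambda>i. s i * r i) A (\<lambda>j. t j * r (m + j))"
        unfolding b by (simp add: bilin_def B_def mult_ac)
      also have "\<dots> \<le> spectral_pnorm p m n A"
      proof (intro bilin_le_spectral p)
        have "(\<Sum>i<m. \<bar>s i * r i\<bar> powr p) = (\<Sum>i<m. \<bar>X i i\<bar> powr (p / 2))"
          using st r r0 by (intro sum.cong refl) (simp add: abs_mult)
        then show "(\<Sum>i<m. \<bar>s i * r i\<bar> powr p) \<le> 1" using X by (simp add: pv_feasible_def)
        have "(\<Sum>j<n. \<bar>t j * r (m + j)\<bar> powr p) = (\<Sum>i\<in>{m..<m+n}. \<bar>X i i\<bar> powr (p / 2))"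
          unfolding sum_atLeastLessThan_add using st r r0 by (intro sum.cong refl) (simp add: abs_mult)
        then show "(\<Sum>j<n. \<bar>t j * r (m + j)\<bar> powr p) \<le> 1" using X by (simp add: pv_feasible_def)
      qed
      finally show "b \<le> spectral_pnorm p m n A" .
    qed
  qed (use grothendieck_constant_ge_1 in linarith)
  finally show ?thesis .
qed

lemma blk_le_pv_norm:
  assumes "p > 0" "m > 0" "n > 0" "pv_feasible p m n X"
  shows "mat_inner (m + n) (m + n) (blk m n A) X \<le> pv_norm p m n A"
  unfolding pv_norm_eq
proof (rule cSup_upper)
  show "bdd_above {mat_inner (m + n) (m + n) (blk m n A) X | X. pv_feasible p m n X}"
    using blk_le_grothendieck_spectral[OF assms(1-3)]
    by (intro bdd_aboveI[of _ "grothendieck_constant * spectral_pnorm p m n A"]) blast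
qed (use assms in blast)

lemma pv_feasible_zero: "p > 0 \<Longrightarrow> pv_feasible p m n (\<lambda>_ _. 0)"
  by (simp add: pv_feasible_def psd_def)

lemma pv_norm_le:
  assumes "p > 0" "\<And>X. pv_feasible p m n X \<Longrightarrow> mat_inner (m + n) (m + n) (blk m n A) X \<le> c"
  shows "pv_norm p m n A \<le> c"
  unfolding pv_norm_eq using assms pv_feasible_zero by (intro cSup_least) blast+

lemma spectral_le_pv_norm:
  assumes p: "p > 0" "m > 0" "n > 0"
  shows "spectral_pnorm p m n A \<le> pv_norm p m n A"
  unfolding spectral_pnorm_def
proof (rule cSup_least)
  show "{bilin m n x A y | x y. vec_pnorm p m x = 1 \<and> vec_pnorm p n y = 1} \<noteq> {}"
    using vec_pnorm_unit[OF p(2,1)] vec_pnorm_unit[OF p(3,1)] by blast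
next
  fix b assume "b \<in> {bilin m n x A y | x y. vec_pnorm p m x = 1 \<and> vec_pnorm p n y = 1}"
  then obtain x y where b: "b = bilin m n x A y"
    and xy: "(\<Sum>i<m. \<bar>x i\<bar> powr p) \<le> 1" "(\<Sum>j<n. \<bar>y j\<bar> powr p) \<le> 1"
    using p(1) by (auto simp: vec_pnorm_eq_1_iff)
  show "b \<le> pv_norm p m n A"
    using blk_le_pv_norm[OF p pv_feasible_rank_one(1)[OF xy], of A]
    unfolding pv_feasible_rank_one(2)[OF xy] b .
qed

subsection \<open>Duality of nuclear and spectral norm\<close>

text \<open>The limit of a minimising sequence for the distance to the origin is the normal of a
  separating hyperplane; it exists for convex sets that are not closed as well.\<close>

lemma separation_from_zero:
  fixes C :: "('i \<Rightarrow> real) set"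
  assumes "finite I" and ne: "C \<noteq> {}"
    and conv: "\<And>x y s. x \<in> C \<Longrightarrow> y \<in> C \<Longrightarrow> 0 \<le> s \<Longrightarrow> s \<le> 1 \<Longrightarrow> (\<lambda>i. (1 - s) * x i + s * y i) \<in> C"
    and far: "\<And>x. x \<in> C \<Longrightarrow> \<delta> \<le> (\<Sum>i\<in>I. (x i)\<^sup>2)"
  obtains y where "\<And>x. x \<in> C \<Longrightarrow> \<delta> \<le> (\<Sum>i\<in>I. y i * x i)"
proof -
  define q where "q = (\<lambda>x. \<Sum>i\<in>I. (x i :: real)\<^sup>2)"
  define D where "D = Inf (q ` C)"
  have bdd: "bdd_below (q ` C)"
    by (rule bdd_belowI[of _ 0]) (auto simp: q_def sum_nonneg)
  have D_le: "D \<le> q x" if "x \<in> C" for x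
    unfolding D_def using bdd that by (intro cInf_lower) auto
  have "\<delta> \<le> D" unfolding D_def using ne far by (intro cInf_greatest) (auto simp: q_def)
  have "\<exists>x\<in>C. q x < D + inverse (real (Suc k))" for k
  proof -
    have "Inf (q ` C) < D + inverse (real (Suc k))" by (simp add: D_def)
    then show ?thesis using ne bdd by (simp add: cInf_less_iff)
  qed
  then obtain c where c: "\<And>k. c k \<in> C" "\<And>k. q (c k) < D + inverse (real (Suc k))"
    by metis
  have inv0: "(\<lambda>k. inverse (real (Suc k))) \<longlonglongrightarrow> 0" by (rule LIMSEQ_inverse_real_of_nat)
  have qc: "(\<lambda>k. q (c k)) \<longlonglongrightarrow> D"
  proof (rule tendsto_sandwich[of "\<lambda>_. D" _ _ "\<lambda>k. D + inverse (real (Suc k))"])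
    show "(\<lambda>k. D + inverse (real (Suc k))) \<longlonglongrightarrow> D"
      using tendsto_add[OF tendsto_const inv0, of D] by simp
  qed (use D_le[OF c(1)] c(2) in \<open>auto intro!: always_eventually less_imp_le\<close>)
  \<comment> \<open>Parallelogram identity: the midpoint lies in \<open>C\<close>, so its square
    norm is at least \<open>D\<close>, and near-minimisers are close to each other.\<close>
  have close: "(c k i - c l i)\<^sup>2 \<le> 2 * inverse (real (Suc k)) + 2 * inverse (real (Suc l))"
    if "i \<in> I" for i k l
  proof -
    have "(\<lambda>i. (1 - 1/2) * c k i + (1/2) * c l i) \<in> C" by (intro conv c) auto
    then have "D \<le> q (\<lambda>i. (1 - 1/2) * c k i + (1/2) * c l i)" by (rule D_le)
    moreover have "q (\<lambda>i. c k i - c l i)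
        = 2 * q (c k) + 2 * q (c l) - 4 * q (\<lambda>i. (1 - 1/2) * c k i + (1/2) * c l i)"
      unfolding q_def sum_distrib_left sum.distrib[symmetric] sum_subtractf[symmetric]
      by (intro sum.cong refl) (simp add: power2_eq_square field_simps)
    moreover have "(c k i - c l i)\<^sup>2 \<le> q (\<lambda>i. c k i - c l i)"
      unfolding q_def using \<open>finite I\<close> that
      by (intro member_le_sum[where f = "\<lambda>i. (c k i - c l i)\<^sup>2"]) auto
    ultimately show ?thesis using c(2)[of k] c(2)[of l] by linarith
  qed
  have "convergent (\<lambda>k. c k i)" if i: "i \<in> I" for i
  proof (rule Cauchy_convergent, rule metric_CauchyI)
    fix e :: real assume "e > 0"
    then have "\<forall>\<^sub>F k in sequentially. inverse (real (Suc k)) < e\<^sup>2 / 4"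
      by (intro order_tendstoD(2)[OF inv0]) auto
    then obtain N where N: "\<And>k. k \<ge> N \<Longrightarrow> inverse (real (Suc k)) < e\<^sup>2 / 4"
      by (auto simp: eventually_sequentially)
    have "dist (c k i) (c l i) < e" if "k \<ge> N" "l \<ge> N" for k l
    proof -
      have "(c k i - c l i)\<^sup>2 < e\<^sup>2"
        using close[OF i, of k l] N[OF that(1)] N[OF that(2)] by linarith
      then show ?thesis
        using \<open>e > 0\<close> by (simp add: dist_real_def power2_less_imp_less[of "\<bar>c k i - c l i\<bar>"])
    qed
    then show "\<exists>M. \<forall>k\<ge>M. \<forall>l\<ge>M. dist (c k i) (c l i) < e" by blast
  qed
  then have lim: "(\<lambda>k. c k i) \<longlonglongrightarrow> lim (\<lambda>k. c k i)" if "i \<in> I" for i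
    using that by (simp add: convergent_LIMSEQ_iff)
  define y where "y = (\<lambda>i. lim (\<lambda>k. c k i))"
  have "\<delta> \<le> (\<Sum>i\<in>I. y i * x i)" if x: "x \<in> C" for x
  proof -
    define a where "a = (\<Sum>i\<in>I. y i * x i) - D"
    define b where "b = q (\<lambda>i. x i - y i)"
    \<comment> \<open>First variation along the segment from \<open>c k\<close> to \<open>x\<close>.
      The limit in \<open>k\<close> is taken at fixed \<open>s\<close>, so \<open>y\<close> may lie
      outside \<open>C\<close>; \<open>s\<close> tends to 0 only afterwards.\<close>
    have var: "0 \<le> 2 * a + s * b" if s: "0 < s" "s \<le> 1" for s
    proof -
      have ineq: "D \<le> q (c k) + 2 * s * ((\<Sum>i\<in>I. c k i * x i) - q (c k)) + s\<^sup>2 * q (\<lambda>i. x i - c k i)" for k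
      proof -
        have "D \<le> q (\<lambda>i. (1 - s) * c k i + s * x i)"
          using s x c by (intro D_le conv) auto
        also have "\<dots> = q (c k) + 2 * s * ((\<Sum>i\<in>I. c k i * x i) - q (c k)) + s\<^sup>2 * q (\<lambda>i. x i - c k i)"
          unfolding q_def sum_distrib_left sum.distrib[symmetric] sum_subtractf[symmetric]
          by (intro sum.cong refl) (simp add: power2_eq_square algebra_simps)
        finally show ?thesis .
      qed
      have "(\<lambda>k. q (c k) + 2 * s * ((\<Sum>i\<in>I. c k i * x i) - q (c k)) + s\<^sup>2 * q (\<lambda>i. x i - c k i))
          \<longlonglongrightarrow> D + 2 * s * ((\<Sum>i\<in>I. y i * x i) - D) + s\<^sup>2 * b"
        unfolding b_def
        by (intro tendsto_intros qc) (auto simp: q_def y_def intro!: tendsto_intros lim)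
      then have "D \<le> D + 2 * s * a + s\<^sup>2 * b"
        unfolding a_def[symmetric] by (rule LIMSEQ_le_const) (use ineq in blast)
      then have "0 \<le> s * (2 * a + s * b)" by (simp add: power2_eq_square algebra_simps)
      then show ?thesis using s by (simp add: zero_le_mult_iff)
    qed
    have "((\<lambda>s. 2 * a + s * b) \<longlongrightarrow> 2 * a + 0 * b) (at_right 0)"
      by (intro tendsto_intros)
    moreover have "\<forall>\<^sub>F s in at_right (0::real). 0 \<le> 2 * a + s * b"
      unfolding eventually_at_right_field using var by (intro exI[of _ 1]) auto
    ultimately have "0 \<le> 2 * a + 0 * b"
      by (intro tendsto_lowerbound[of "\<lambda>s. 2 * a + s * b"]) auto
    then show ?thesis using \<open>\<delta> \<le> D\<close> by (simp add: a_def)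
  qed
  then show ?thesis using that by blast
qed

text \<open>Carrying the cost \<open>c\<close> of a decomposition explicitly lets decompositions be
  added and scaled without a minimal one.\<close>

definition nuclear_rep :: "real \<Rightarrow> nat \<Rightarrow> nat \<Rightarrow> (nat \<Rightarrow> nat \<Rightarrow> real) \<Rightarrow> real \<Rightarrow> bool" where
  "nuclear_rep p m n A c \<longleftrightarrow> (\<exists>(r::nat) lam xs ys.
     (\<forall>k<r. vec_pnorm p m (xs k) = 1 \<and> vec_pnorm p n (ys k) = 1) \<and>
     (\<forall>i<m. \<forall>j<n. A i j = (\<Sum>k<r. lam k * xs k i * ys k j)) \<and> c = (\<Sum>k<r. \<bar>lam k\<bar>))"

lemma nuclear_pnorm_eq: "nuclear_pnorm p m n A = Inf {c. nuclear_rep p m n A c}"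
  unfolding nuclear_pnorm_def nuclear_rep_def by (rule arg_cong[where f = Inf]) blast

lemma nuclear_rep_cong:
  assumes "nuclear_rep p m n A c" "\<And>i j. i < m \<Longrightarrow> j < n \<Longrightarrow> B i j = A i j"
  shows "nuclear_rep p m n B c"
  using assms unfolding nuclear_rep_def by auto

lemma nuclear_rep_nonneg: "nuclear_rep p m n A c \<Longrightarrow> 0 \<le> c"
  by (auto simp: nuclear_rep_def sum_nonneg)

lemma nuclear_rep_zero: "nuclear_rep p m n (\<lambda>_ _. 0) 0"
  unfolding nuclear_rep_def by (rule exI[of _ 0]) simp

lemma nuclear_rep_rank_one:
  assumes "vec_pnorm p m x = 1" "vec_pnorm p n y = 1"
  shows "nuclear_rep p m n (\<lambda>i j. a * x i * y j) \<bar>a\<bar>"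
  unfolding nuclear_rep_def
  by (rule exI[of _ 1], rule exI[of _ "\<lambda>_. a"], rule exI[of _ "\<lambda>_. x"], rule exI[of _ "\<lambda>_. y"])
    (use assms in simp)

lemma nuclear_rep_add:
  assumes "nuclear_rep p m n A c" "nuclear_rep p m n B d"
  shows "nuclear_rep p m n (\<lambda>i j. A i j + B i j) (c + d)"
proof -
  obtain r :: nat and lam xs ys where 1: "\<forall>k<r. vec_pnorm p m (xs k) = 1 \<and> vec_pnorm p n (ys k) = 1"
    "\<forall>i<m. \<forall>j<n. A i j = (\<Sum>k<r. lam k * xs k i * ys k j)" "c = (\<Sum>k<r. \<bar>lam k\<bar>)"
    using assms(1) unfolding nuclear_rep_def by blast
  obtain r' :: nat and lam' xs' ys' where 2: "\<forall>k<r'. vec_pnorm p m (xs' k) = 1 \<and> vec_pnorm p n (ys' k) = 1"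
    "\<forall>i<m. \<forall>j<n. B i j = (\<Sum>k<r'. lam' k * xs' k i * ys' k j)" "d = (\<Sum>k<r'. \<bar>lam' k\<bar>)"
    using assms(2) unfolding nuclear_rep_def by blast
  show ?thesis
    unfolding nuclear_rep_def
    by (rule exI[of _ "r + r'"], rule exI[of _ "\<lambda>k. if k < r then lam k else lam' (k - r)"],
        rule exI[of _ "\<lambda>k. if k < r then xs k else xs' (k - r)"],
        rule exI[of _ "\<lambda>k. if k < r then ys k else ys' (k - r)"])
      (use 1 2 in \<open>simp add: sum_lessThan_add\<close>)
qed

lemma nuclear_rep_scale:
  assumes "nuclear_rep p m n A c"
  shows "nuclear_rep p m n (\<lambda>i j. s * A i j) (\<bar>s\<bar> * c)"
proof -
  obtain r :: nat and lam xs ys where 1: "\<forall>k<r. vec_pnorm p m (xs k) = 1 \<and> vec_pnorm p n (ys k) = 1"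
    "\<forall>i<m. \<forall>j<n. A i j = (\<Sum>k<r. lam k * xs k i * ys k j)" "c = (\<Sum>k<r. \<bar>lam k\<bar>)"
    using assms(1) unfolding nuclear_rep_def by blast
  show ?thesis
    unfolding nuclear_rep_def
    by (rule exI[of _ r], rule exI[of _ "\<lambda>k. s * lam k"], rule exI[of _ xs], rule exI[of _ ys])
      (use 1 in \<open>simp add: sum_distrib_left abs_mult mult_ac\<close>)
qed

lemma nuclear_rep_sum:
  assumes "finite I" "\<And>k. k \<in> I \<Longrightarrow> nuclear_rep p m n (W k) (c k)"
  shows "nuclear_rep p m n (\<lambda>i j. \<Sum>k\<in>I. W k i j) (\<Sum>k\<in>I. c k)"
  using assms
proof (induction I rule: finite_induct)
  case empty
  then show ?case by (simp add: nuclear_rep_zero)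
next
  case (insert k I)
  then show ?case by (simp add: nuclear_rep_add)
qed

text \<open>Besides showing that decompositions exist, this bounds the cost of a small perturbation,
  from which the distance needed for separation is obtained.\<close>

lemma nuclear_rep_entries:
  assumes "p > 0"
  shows "nuclear_rep p m n A (\<Sum>i<m. \<Sum>j<n. \<bar>A i j\<bar>)"
proof -
  define e where "e = (\<lambda>a i::nat. if i = a then 1 else 0 :: real)"
  have "nuclear_rep p m n (\<lambda>i j. \<Sum>a<m. \<Sum>b<n. A a b * e a i * e b j) (\<Sum>a<m. \<Sum>b<n. \<bar>A a b\<bar>)"
    using assms unfolding e_def
    by (intro nuclear_rep_sum nuclear_rep_rank_one vec_pnorm_unit) auto
  moreover have "A i j = (\<Sum>a<m. \<Sum>b<n. A a b * e a i * e b j)" if "i < m" "j < n" for i j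
  proof -
    have "(\<Sum>b<n. A a b * e a i * e b j) = (if a = i then A i j else 0)" for a
      using that by (auto simp: e_def if_distrib cong: if_cong)
    then show ?thesis using that by simp
  qed
  ultimately show ?thesis by (rule nuclear_rep_cong)
qed

lemma nuclear_pnorm_le:
  assumes "nuclear_rep p m n A c"
  shows "nuclear_pnorm p m n A \<le> c"
  unfolding nuclear_pnorm_eq
  using assms nuclear_rep_nonneg by (intro cInf_lower bdd_belowI[of _ 0]) auto

text \<open>Weak duality, term by term; negating one vector bounds the absolute value of each
  bilinear term.\<close>

lemma mat_inner_nuclear_rep_le:
  assumes p: "p > 0" and A: "nuclear_rep p m n A c" and Z: "spectral_pnorm p m n Z \<le> 1"
  shows "mat_inner m n A Z \<le> c"
proof -
  obtain r :: nat and lam xs ys where 1: "\<forall>k<r. vec_pnorm p m (xs k) = 1 \<and> vec_pnorm p n (ys k) = 1"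
    "\<forall>i<m. \<forall>j<n. A i j = (\<Sum>k<r. lam k * xs k i * ys k j)" "c = (\<Sum>k<r. \<bar>lam k\<bar>)"
    using A unfolding nuclear_rep_def by blast
  have "mat_inner m n A Z = (\<Sum>i<m. \<Sum>j<n. \<Sum>k<r. lam k * (xs k i * Z i j * ys k j))"
    using 1(2) unfolding mat_inner_def
    by (intro sum.cong refl) (simp add: sum_distrib_left mult_ac)
  also have "\<dots> = (\<Sum>i<m. \<Sum>k<r. \<Sum>j<n. lam k * (xs k i * Z i j * ys k j))"
    by (intro sum.cong refl sum.swap)
  also have "\<dots> = (\<Sum>k<r. \<Sum>i<m. \<Sum>j<n. lam k * (xs k i * Z i j * ys k j))"
    by (rule sum.swap)
  also have "\<dots> = (\<Sum>k<r. lam k * bilin m n (xs k) Z (ys k))"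
    by (simp add: bilin_def sum_distrib_left)
  also have "\<dots> \<le> (\<Sum>k<r. \<bar>lam k\<bar>)"
  proof (rule sum_mono)
    fix k assume "k \<in> {..<r}"
    then have xy: "vec_pnorm p m (xs k) = 1" "vec_pnorm p n (ys k) = 1" using 1(1) by auto
    then have "vec_pnorm p m (\<lambda>i. - xs k i) = 1" by (simp add: vec_pnorm_def)
    then have "bilin m n (\<lambda>i. - xs k i) Z (ys k) \<le> 1" "bilin m n (xs k) Z (ys k) \<le> 1"
      using bilin_le_spectral_unit[OF p _ xy(2), of m _ Z] xy(1) Z by fastforce+
    moreover have "bilin m n (\<lambda>i. - xs k i) Z (ys k) = - bilin m n (xs k) Z (ys k)"
      using bilin_scale[of m n "-1" "xs k" Z 1 "ys k"] by simp
    ultimately have "\<bar>bilin m n (xs k) Z (ys k)\<bar> \<le> 1" by linarith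
    then have "\<bar>lam k * bilin m n (xs k) Z (ys k)\<bar> \<le> \<bar>lam k\<bar>"
      by (simp add: abs_mult mult_left_le)
    then show "lam k * bilin m n (xs k) Z (ys k) \<le> \<bar>lam k\<bar>" by linarith
  qed
  finally show ?thesis by (simp add: 1(3))
qed

lemma mat_inner_le_nuclear_pnorm:
  assumes p: "p > 0" and Z: "spectral_pnorm p m n Z \<le> 1"
  shows "mat_inner m n A Z \<le> nuclear_pnorm p m n A"
  unfolding nuclear_pnorm_eq
  using nuclear_rep_entries[OF p] mat_inner_nuclear_rep_le[OF p _ Z] by (intro cInf_greatest) auto

lemma spectral_pnorm_le:
  assumes "p > 0" "m > 0" "n > 0"
    and "\<And>x y. vec_pnorm p m x = 1 \<Longrightarrow> vec_pnorm p n y = 1 \<Longrightarrow> bilin m n x A y \<le> c"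
  shows "spectral_pnorm p m n A \<le> c"
  unfolding spectral_pnorm_def
  using vec_pnorm_unit[OF assms(2,1)] vec_pnorm_unit[OF assms(3,1)] assms(4)
  by (intro cSup_least) blast+

lemma mat_inner_scale: "mat_inner m n A (\<lambda>i j. c * Z i j) = c * mat_inner m n A Z"
  by (simp add: mat_inner_def sum_distrib_left mult_ac)

text \<open>Strong duality up to attainment: \<open>A\<close> is separated from the matrices with a
  decomposition of cost at most \<open>L\<close>. The error \<open>A - W\<close> costs at most its
  entrywise absolute sum, which therefore is at least the gap \<open>g\<close>; Cauchy-Schwarz over
  the \<open>m * n\<close> entries converts this into Euclidean distance.\<close>

lemma nuclear_dual_witness:
  assumes p: "p > 0" "m > 0" "n > 0" and L: "0 < L" "L < nuclear_pnorm p m n A"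
  obtains Z where "spectral_pnorm p m n Z \<le> 1" "mat_inner m n A Z = L"
proof -
  define I where "I = {..<m} \<times> {..<n}"
  define C where "C = {(\<lambda>(i, j). A i j - W i j) | W c. nuclear_rep p m n W c \<and> c \<le> L}"
  define g where "g = nuclear_pnorm p m n A - L"
  have g: "g > 0" using L by (simp add: g_def)
  have mem: "(\<lambda>(i, j). A i j - W i j) \<in> C" if "nuclear_rep p m n W c" "c \<le> L" for W c
    using that unfolding C_def by blast
  obtain y where y: "\<And>x. x \<in> C \<Longrightarrow> g\<^sup>2 / real (m * n) \<le> (\<Sum>k\<in>I. y k * x k)"
  proof (rule separation_from_zero)
    show "finite I" by (simp add: I_def)
    show "C \<noteq> {}" using mem[OF nuclear_rep_zero] L by auto
  next
    fix x x' and s :: real assume "x \<in> C" "x' \<in> C" and s: "0 \<le> s" "s \<le> 1"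
    then obtain W c W' c' where W: "x = (\<lambda>(i, j). A i j - W i j)" "nuclear_rep p m n W c" "c \<le> L"
      "x' = (\<lambda>(i, j). A i j - W' i j)" "nuclear_rep p m n W' c'" "c' \<le> L"
      unfolding C_def by blast
    have "nuclear_rep p m n (\<lambda>i j. (1 - s) * W i j + s * W' i j) (\<bar>1 - s\<bar> * c + \<bar>s\<bar> * c')"
      by (intro nuclear_rep_add nuclear_rep_scale W)
    moreover have "\<bar>1 - s\<bar> * c + \<bar>s\<bar> * c' \<le> L"
      using convex_bound_le[OF W(3,6), of "1 - s" s] s by simp
    ultimately have "(\<lambda>(i, j). A i j - ((1 - s) * W i j + s * W' i j)) \<in> C" by (rule mem)
    moreover have "(\<lambda>(i, j). A i j - ((1 - s) * W i j + s * W' i j)) = (\<lambda>k. (1 - s) * x k + s * x' k)"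
      by (auto simp: W algebra_simps)
    ultimately show "(\<lambda>k. (1 - s) * x k + s * x' k) \<in> C" by simp
  next
    fix x assume "x \<in> C"
    then obtain W c where W: "x = (\<lambda>(i, j). A i j - W i j)" "nuclear_rep p m n W c" "c \<le> L"
      unfolding C_def by blast
    define E where "E = (\<lambda>i j. A i j - W i j)"
    have "nuclear_rep p m n (\<lambda>i j. W i j + E i j) (c + (\<Sum>i<m. \<Sum>j<n. \<bar>E i j\<bar>))"
      by (intro nuclear_rep_add W nuclear_rep_entries p)
    then have "nuclear_pnorm p m n A \<le> c + (\<Sum>i<m. \<Sum>j<n. \<bar>E i j\<bar>)"
      by (intro nuclear_pnorm_le) (simp add: E_def)
    moreover have "(\<Sum>i<m. \<Sum>j<n. \<bar>E i j\<bar>) = (\<Sum>k\<in>I. \<bar>x k\<bar> * 1)"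
      by (simp add: I_def sum.cartesian_product W(1) E_def case_prod_unfold)
    ultimately have "g \<le> (\<Sum>k\<in>I. \<bar>x k\<bar> * 1)"
      using W(3) by (simp add: g_def)
    then have "g\<^sup>2 \<le> (\<Sum>k\<in>I. \<bar>x k\<bar> * 1)\<^sup>2" using g by (intro power_mono) auto
    also have "\<dots> \<le> (\<Sum>k\<in>I. \<bar>x k\<bar>\<^sup>2) * (\<Sum>k\<in>I. 1\<^sup>2)" by (rule Cauchy_Schwarz_ineq_sum)
    also have "\<dots> = (\<Sum>k\<in>I. (x k)\<^sup>2) * real (m * n)" by (simp add: I_def)
    finally show "g\<^sup>2 / real (m * n) \<le> (\<Sum>k\<in>I. (x k)\<^sup>2)"
      using p by (simp add: pos_divide_le_eq)
  qed (use that in blast)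
  define Y where "Y = (\<lambda>i j. y (i, j))"
  define s where "s = mat_inner m n A Y"
  have sep: "g\<^sup>2 / real (m * n) \<le> s - mat_inner m n W Y" if "nuclear_rep p m n W c" "c \<le> L" for W c
    using y[OF mem[OF that]]
    by (simp add: I_def sum.cartesian_product case_prod_unfold s_def Y_def mat_inner_def
        sum_subtractf[symmetric] algebra_simps)
  have "0 < g\<^sup>2 / real (m * n)" using g p by simp
  then have s: "s > 0" using sep[OF nuclear_rep_zero] L by (simp add: mat_inner_def)
  \<comment> \<open>Tested on the rank-one matrix \<open>L * x i * z j\<close>, of cost
    \<open>L\<close>, the separation says \<open>L * bilin m n x Y z \<le> s\<close>, which dictates
    the scaling \<open>L / s\<close>.\<close>
  have "spectral_pnorm p m n (\<lambda>i j. L / s * Y i j) \<le> 1"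
  proof (rule spectral_pnorm_le[OF p])
    fix x z assume xz: "vec_pnorm p m x = 1" "vec_pnorm p n z = 1"
    have "mat_inner m n (\<lambda>i j. L * x i * z j) Y = L * bilin m n x Y z"
      by (simp add: mat_inner_def bilin_def sum_distrib_left mult_ac)
    then have "L * bilin m n x Y z \<le> s"
      using sep[OF nuclear_rep_rank_one[OF xz, of L]] L \<open>0 < g\<^sup>2 / real (m * n)\<close> by simp
    moreover have "bilin m n x (\<lambda>i j. L / s * Y i j) z = L * bilin m n x Y z / s"
      by (simp add: bilin_def sum_distrib_left sum_divide_distrib mult_ac)
    ultimately show "bilin m n x (\<lambda>i j. L / s * Y i j) z \<le> 1"
      using s by simp
  qed
  moreover have "mat_inner m n A (\<lambda>i j. L / s * Y i j) = L / s * s"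
    unfolding s_def by (rule mat_inner_scale)
  then have "mat_inner m n A (\<lambda>i j. L / s * Y i j) = L" using s by simp
  ultimately show ?thesis using that by blast
qed

subsection \<open>The conic program bounds the relaxation\<close>

lemma theta_eq:
  assumes "p > 2"
  shows "theta p = (2 / p) powr (2 / (p - 2)) * (1 - 2 / p)"
proof -
  have "p / (p - 2) = 2 / (p - 2) + 1" using assms by (simp add: field_simps)
  then have "(2 / p) powr (p / (p - 2)) = (2 / p) powr (2 / (p - 2)) * (2 / p)"
    using assms by (simp add: powr_add)
  then show ?thesis by (simp add: theta_def algebra_simps)
qed

text \<open>Weighted AM-GM; \<open>theta p\<close> is the smallest constant for which it holds.\<close>

lemma powr_mult_le_theta:
  assumes p: "p > 2" and "0 \<le> u" "0 \<le> T"
  shows "T powr (1 - 2 / p) * u powr (2 / p) \<le> u + theta p * T"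
proof (cases "u = 0 \<or> T = 0")
  case True
  have "0 \<le> theta p" using p by (simp add: theta_eq)
  then show ?thesis using True assms by auto
next
  case False
  then have pos: "u > 0" "T > 0" using assms by auto
  define a where "a = 2 / p"
  have a: "0 < a" "a < 1" using p by (simp_all add: a_def)
  \<comment> \<open>Solves \<open>c powr (1 - a) = a powr a\<close>, so that the left side of
    Young's inequality has coefficient 1; then \<open>(1 - a) * c\<close> is
    \<open>theta p\<close>.\<close>
  define c where "c = a powr (2 / (p - 2))"
  have c: "c > 0" using a by (simp add: c_def)
  have ca: "c powr (1 - a) = a powr a"
  proof -
    have "2 / (p - 2) * (1 - a) = a" using p by (simp add: a_def field_simps)
    then show ?thesis by (simp add: c_def powr_powr)
  qed
  have "(u / a) powr a * (c * T) powr (1 - a) \<le> a * (u / a) + (1 - a) * (c * T)"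
    using a c pos by (intro Youngs_inequality_0) auto
  also have "(u / a) powr a * (c * T) powr (1 - a) = T powr (1 - a) * u powr a"
    using a c pos by (simp add: powr_divide powr_mult ca)
  also have "a * (u / a) + (1 - a) * (c * T) = u + theta p * T"
    using a p by (simp add: theta_eq a_def[symmetric] c_def)
  finally show ?thesis by (simp add: a_def)
qed

text \<open>Taking roots, the cone condition gives
  \<open>v \<le> t powr (1 - 2 / p) * u powr (2 / p)\<close>. The factor \<open>x\<close> is drawn
  into the second power as \<open>x powr (p / 2)\<close> before AM-GM applies.\<close>

lemma in_Kp_mult_le:
  assumes p: "p > 2" and K: "in_Kp p v u t" and x: "0 \<le> x"
  shows "v * x \<le> u * x powr (p / 2) + theta p * t"
proof -
  have v: "0 \<le> u" "0 \<le> v" "0 \<le> t" "v powr (p / (p - 2)) \<le> t * u powr (2 / (p - 2))"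
    using K by (simp_all add: in_Kp_def)
  have "v = (v powr (p / (p - 2))) powr ((p - 2) / p)"
    using p v by (simp add: powr_powr)
  also have "\<dots> \<le> (t * u powr (2 / (p - 2))) powr ((p - 2) / p)"
    using p v by (intro powr_mono2) auto
  also have "\<dots> = t powr (1 - 2 / p) * u powr (2 / p)"
  proof -
    have "2 / (p - 2) * ((p - 2) / p) = 2 / p" "(p - 2) / p = 1 - 2 / p"
      using p by (simp_all add: field_simps)
    then show ?thesis using v by (simp only: powr_mult powr_powr)
  qed
  finally have "v * x \<le> t powr (1 - 2 / p) * u powr (2 / p) * x"
    using x by (rule mult_right_mono)
  also have "\<dots> = t powr (1 - 2 / p) * (u * x powr (p / 2)) powr (2 / p)"
    using p v x by (simp add: powr_mult powr_powr)
  also have "\<dots> \<le> u * x powr (p / 2) + theta p * t"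
    using p v by (intro powr_mult_le_theta) auto
  finally show ?thesis .
qed

lemma mat_inner_diff_left:
  "mat_inner m n (\<lambda>i j. A i j - B i j) X = mat_inner m n A X - mat_inner m n B X"
  by (simp add: mat_inner_def left_diff_distrib sum_subtractf)

lemma mat_inner_diag: "mat_inner k k (diag_mat v) X = (\<Sum>i<k. v i * X i i)"
proof -
  have "(\<Sum>j<k. diag_mat v i j * X i j) = v i * X i i" if "i < k" for i
    using that by (simp add: diag_mat_def if_distrib[where f = "\<lambda>x. x * _"] cong: if_cong)
  then show ?thesis by (simp add: mat_inner_def)
qed

text \<open>Weak duality between (P) and the program defining pv: pairing the matrix inequality with
  \<open>X\<close> leaves only its diagonal, which the cone conditions bound block by block.\<close>

lemma P_feasible_pv_norm_le_1:
  assumes p: "p > 2" "m > 0" "n > 0" and P: "P_feasible p m n Z u1 u2 v t"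
  shows "pv_norm p m n Z \<le> 1"
proof (rule pv_norm_le)
  show "p > 0" using p by simp
  fix X assume X: "pv_feasible p m n X"
  then have psd: "psd (m + n) X" by (simp add: pv_feasible_def)
  have x0: "0 \<le> X i i" if "i < m + n" for i using psd_diag_nonneg[OF psd that] .
  have blockwise: "(\<Sum>i\<in>I. v i * X i i) \<le> u + theta p * (\<Sum>i\<in>I. t i)"
    if "I \<subseteq> {..<m + n}" "0 \<le> u" "\<And>i. i \<in> I \<Longrightarrow> in_Kp p (v i) u (t i)"
      "(\<Sum>i\<in>I. \<bar>X i i\<bar> powr (p / 2)) \<le> 1" for I u
  proof -
    have "(\<Sum>i\<in>I. v i * X i i) \<le> (\<Sum>i\<in>I. u * \<bar>X i i\<bar> powr (p / 2) + theta p * t i)"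
    proof (rule sum_mono)
      fix i assume "i \<in> I"
      then show "v i * X i i \<le> u * \<bar>X i i\<bar> powr (p / 2) + theta p * t i"
        using in_Kp_mult_le[OF p(1) that(3), of i "X i i"] x0[of i] that(1) by auto
    qed
    also have "\<dots> = u * (\<Sum>i\<in>I. \<bar>X i i\<bar> powr (p / 2)) + theta p * (\<Sum>i\<in>I. t i)"
      by (simp add: sum.distrib sum_distrib_left)
    also have "\<dots> \<le> u + theta p * (\<Sum>i\<in>I. t i)"
      using mult_left_mono[OF that(4,2)] by simp
    finally show ?thesis .
  qed
  have K1: "in_Kp p (v i) u1 (t i)" if "i < m" for i
    using P that by (simp add: P_feasible_def)
  have K2: "in_Kp p (v i) u2 (t i)" if "i \<in> {m..<m+n}" for i
    using P that by (simp add: P_feasible_def)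
  \<comment> \<open>The sign of \<open>u1\<close> is available only through a cone membership, so a
    block must contain an index.\<close>
  have "0 \<le> u1" using K1[of 0] p by (simp add: in_Kp_def)
  then have 1: "(\<Sum>i<m. v i * X i i) \<le> u1 + theta p * (\<Sum>i<m. t i)"
    using X K1 by (intro blockwise) (auto simp: pv_feasible_def)
  have "0 \<le> u2" using K2[of m] p by (simp add: in_Kp_def)
  then have 2: "(\<Sum>i\<in>{m..<m+n}. v i * X i i) \<le> u2 + theta p * (\<Sum>i\<in>{m..<m+n}. t i)"
    using X K2 by (intro blockwise) (auto simp: pv_feasible_def)
  have "0 \<le> mat_inner (m + n) (m + n) (\<lambda>i j. diag_mat v i j - blk m n Z i j) X"
    using P psd by (intro mat_inner_psd_nonneg) (simp_all add: P_feasible_def)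
  then have "mat_inner (m + n) (m + n) (blk m n Z) X \<le> (\<Sum>i<m + n. v i * X i i)"
    by (simp add: mat_inner_diff_left mat_inner_diag)
  also have "\<dots> \<le> u1 + u2 + theta p * (\<Sum>i<m + n. t i)"
    using 1 2 by (simp add: sum_split_blocks distrib_left)
  also have "\<dots> \<le> 1" using P by (simp add: P_feasible_def)
  finally show "mat_inner (m + n) (m + n) (blk m n Z) X \<le> 1" .
qed

text \<open>The equality case of Hoelder's inequality for the exponents \<open>p / 2\<close> and \<open>p / (p - 2)\<close>.\<close>

lemma powr_norming_vector:
  fixes x :: "nat \<Rightarrow> real"
  assumes p: "p > 2" and "finite I" and x: "\<And>i. i \<in> I \<Longrightarrow> 0 \<le> x i"
  obtains v where "\<And>i. 0 \<le> v i"
    "\<And>w. (\<And>i. i \<in> I \<Longrightarrow> 0 \<le> w i) \<Longrightarrow> (\<Sum>i\<in>I. w i powr (p / 2)) \<le> 1 \<Longrightarrow> (\<Sum>i\<in>I. v i * w i) \<le> 1"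
    "(\<Sum>i\<in>I. v i * x i) = (\<Sum>i\<in>I. x i powr (p / 2)) powr (2 / p)"
proof (cases "(\<Sum>i\<in>I. x i powr (p / 2)) = 0")
  case True
  then show ?thesis using that[of "\<lambda>_. 0"] by simp
next
  case False
  define S where "S = (\<Sum>i\<in>I. x i powr (p / 2))"
  define M where "M = S powr (2 / p)"
  have S: "S > 0" using False by (simp add: S_def sum_nonneg order_less_le)
  then have M: "M > 0" "M powr (p / 2) = S" using p by (simp_all add: M_def powr_powr)
  \<comment> \<open>The gradient of the \<open>p / 2\<close>-norm at \<open>x\<close>. After
    normalisation both power sums are at most 1, so summing Young's inequality gives
    Hoelder's.\<close>
  define v where "v = (\<lambda>i. (x i / M) powr (p / 2 - 1))"
  have norm1: "(\<Sum>i\<in>I. (x i / M) powr (p / 2)) = 1"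
  proof -
    have "(\<Sum>i\<in>I. (x i / M) powr (p / 2)) = (\<Sum>i\<in>I. x i powr (p / 2) / S)"
      using M x by (intro sum.cong refl) (simp add: powr_divide)
    then show ?thesis using S by (simp add: sum_divide_distrib[symmetric] S_def)
  qed
  show ?thesis
  proof (rule that[of v])
    show "0 \<le> v i" for i by (simp add: v_def)
  next
    fix w assume w: "\<And>i. i \<in> I \<Longrightarrow> 0 \<le> w i" "(\<Sum>i\<in>I. w i powr (p / 2)) \<le> (1::real)"
    have "(\<Sum>i\<in>I. v i * w i)
        \<le> (\<Sum>i\<in>I. (x i / M) powr (p / 2) / (p / (p - 2)) + w i powr (p / 2) / (p / 2))"
    proof (rule sum_mono)
      fix i assume "i \<in> I"
      have "v i * w i \<le> v i powr (p / (p - 2)) / (p / (p - 2)) + w i powr (p / 2) / (p / 2)"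
        using p w(1)[OF \<open>i \<in> I\<close>] by (intro Youngs_inequality) (auto simp: v_def field_simps)
      moreover have "v i powr (p / (p - 2)) = (x i / M) powr (p / 2)"
      proof -
        have "(p / 2 - 1) * (p / (p - 2)) = p / 2" using p by (simp add: field_simps)
        then show ?thesis by (simp only: v_def powr_powr)
      qed
      ultimately show "v i * w i \<le> (x i / M) powr (p / 2) / (p / (p - 2)) + w i powr (p / 2) / (p / 2)"
        by simp
    qed
    also have "\<dots> = 1 / (p / (p - 2)) + (\<Sum>i\<in>I. w i powr (p / 2)) / (p / 2)"
      by (simp only: sum.distrib sum_divide_distrib[symmetric] norm1)
    also have "\<dots> \<le> 1 / (p / (p - 2)) + 1 / (p / 2)"
      using p w(2) by (intro add_left_mono divide_right_mono) auto
    also have "\<dots> = 1" using p by (simp add: field_simps)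
    finally show "(\<Sum>i\<in>I. v i * w i) \<le> 1" .
  next
    have "(\<Sum>i\<in>I. v i * x i) = (\<Sum>i\<in>I. M * (x i / M) powr (p / 2))"
    proof (intro sum.cong refl)
      fix i assume "i \<in> I"
      then have "(x i / M) powr (p / 2 - 1) * (x i / M) = (x i / M) powr (p / 2)"
        using x[of i] M p powr_mult_base[of "x i / M" "p / 2 - 1"] by (simp add: mult.commute)
      then have "(x i / M) powr (p / 2 - 1) * x i = M * (x i / M) powr (p / 2)"
        using M by (simp add: field_simps)
      then show "v i * x i = M * (x i / M) powr (p / 2)" by (simp add: v_def)
    qed
    also have "\<dots> = M" by (simp only: sum_distrib_left[symmetric] norm1)
    finally show "(\<Sum>i\<in>I. v i * x i) = (\<Sum>i\<in>I. x i powr (p / 2)) powr (2 / p)"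
      by (simp add: M_def S_def)
  qed
qed

text \<open>Conversely, the \<open>p / (p - 2)\<close>-norm of \<open>v\<close> is attained both by a feasible \<open>w\<close> and by the
  cone variables \<open>u, t\<close>, where \<open>u\<close> is the equality case of \<open>powr_mult_le_theta\<close>.\<close>

lemma in_Kp_norming:
  fixes v :: "nat \<Rightarrow> real"
  assumes p: "p > 2" and "finite I" and v: "\<And>i. i \<in> I \<Longrightarrow> 0 \<le> v i"
  obtains u t w where "\<And>i. 0 \<le> w i" "(\<Sum>i\<in>I. w i powr (p / 2)) \<le> 1"
    "\<And>i. i \<in> I \<Longrightarrow> in_Kp p (v i) u (t i)" "u + theta p * (\<Sum>i\<in>I. t i) = (\<Sum>i\<in>I. v i * w i)"
proof (cases "(\<Sum>i\<in>I. v i powr (p / (p - 2))) = 0")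
  case True
  then have "v i = 0" if "i \<in> I" for i
    using that \<open>finite I\<close> by (simp add: sum_nonneg_eq_0_iff)
  then show ?thesis using that[of "\<lambda>_. 0" 0 "\<lambda>_. 0"] by (simp add: in_Kp_def)
next
  case False
  define q where "q = p / (p - 2)"
  define S where "S = (\<Sum>i\<in>I. v i powr q)"
  define N where "N = S powr (1 / q)"
  have q: "q > 1" "2 / (p - 2) = q - 1" "(q - 1) * (p / 2) = q" using p by (simp_all add: q_def field_simps)
  have S: "S > 0" using False by (simp add: S_def q_def sum_nonneg order_less_le)
  then have N: "N > 0" "N powr q = S" using q by (simp_all add: N_def powr_powr)
  define u where "u = 2 / p * N"
  \<comment> \<open>The least value that the cone allows. With it
    \<open>u + theta p * (\<Sum>i\<in>I. t i)\<close> is a function of \<open>u\<close> whose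
    minimiser is \<open>2 / p * N\<close> and whose minimum is \<open>N\<close>.\<close>
  define t where "t = (\<lambda>i. v i powr q / u powr (q - 1))"
  define w where "w = (\<lambda>i. (v i / N) powr (q - 1))"
  have u: "u > 0" using N p by (simp add: u_def)
  have SN: "S / N powr (q - 1) = N"
    using N by (simp add: N(2)[symmetric] powr_diff)
  show ?thesis
  proof (rule that[of w u t])
    show "0 \<le> w i" for i by (simp add: w_def)
    have "(\<Sum>i\<in>I. w i powr (p / 2)) = (\<Sum>i\<in>I. v i powr q / S)"
      using v N by (intro sum.cong refl) (simp only: w_def powr_powr q(3), simp add: powr_divide)
    then show "(\<Sum>i\<in>I. w i powr (p / 2)) \<le> 1"
      using S by (simp add: sum_divide_distrib[symmetric] S_def)
    show "in_Kp p (v i) u (t i)" if "i \<in> I" for i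
      using v[OF that] u by (simp add: in_Kp_def q(2) q_def[symmetric] t_def)
    have "(\<Sum>i\<in>I. v i * w i) = (\<Sum>i\<in>I. v i powr q / N powr (q - 1))"
    proof (intro sum.cong refl)
      fix i assume "i \<in> I"
      then show "v i * w i = v i powr q / N powr (q - 1)"
        using v[of i] N powr_mult_base[of "v i" "q - 1"] by (simp add: w_def powr_divide)
    qed
    then have vw: "(\<Sum>i\<in>I. v i * w i) = N"
      by (simp add: sum_divide_distrib[symmetric] S_def[symmetric] SN)
    have "(\<Sum>i\<in>I. t i) = S / u powr (q - 1)"
      by (simp add: t_def sum_divide_distrib[symmetric] S_def)
    also have "\<dots> = N / (2 / p) powr (q - 1)"
    proof -
      have "u powr (q - 1) = (2 / p) powr (q - 1) * N powr (q - 1)"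
        unfolding u_def by (rule powr_mult)
      then have "S / u powr (q - 1) = S / N powr (q - 1) / (2 / p) powr (q - 1)"
        by (simp add: mult.commute)
      then show ?thesis by (simp only: SN)
    qed
    finally have "theta p * (\<Sum>i\<in>I. t i) = (1 - 2 / p) * N"
      using p by (simp add: theta_eq q(2))
    then show "u + theta p * (\<Sum>i\<in>I. t i) = (\<Sum>i\<in>I. v i * w i)"
      by (simp add: vw u_def algebra_simps)
  qed
qed

subsection \<open>Feasibility for the conic program\<close>

lemma psd_sum_scale:
  assumes "psd k X" "psd k Y" "0 \<le> a" "0 \<le> b"
  shows "psd k (\<lambda>i j. a * X i j + b * Y i j)"
proof -
  have "quad_form k (\<lambda>i j. a * X i j + b * Y i j) w = a * quad_form k X w + b * quad_form k Y w" for w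
    by (simp add: quad_form_def sum_distrib_left sum.distrib[symmetric] algebra_simps)
  then show ?thesis using assms by (simp add: psd_iff)
qed

text \<open>Cauchy-Schwarz over index pairs: the Frobenius norm dominates the operator norm.\<close>

lemma abs_quad_form_le:
  assumes E: "(\<Sum>i<k. \<Sum>j<k. (E i j)\<^sup>2) \<le> \<eta>\<^sup>2" and "0 \<le> \<eta>"
  shows "\<bar>quad_form k E w\<bar> \<le> \<eta> * (\<Sum>i<k. (w i)\<^sup>2)"
proof -
  define I where "I = {..<k} \<times> {..<k}"
  have "quad_form k E w = (\<Sum>z\<in>I. (case z of (i, j) \<Rightarrow> E i j) * (case z of (i, j) \<Rightarrow> w i * w j))"
    by (simp add: quad_form_def I_def sum.cartesian_product case_prod_unfold mult_ac)
  then have "(quad_form k E w)\<^sup>2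
      \<le> (\<Sum>z\<in>I. (case z of (i, j) \<Rightarrow> E i j)\<^sup>2) * (\<Sum>z\<in>I. (case z of (i, j) \<Rightarrow> w i * w j)\<^sup>2)"
    by (simp only: Cauchy_Schwarz_ineq_sum)
  also have "\<dots> = (\<Sum>i<k. \<Sum>j<k. (E i j)\<^sup>2) * (\<Sum>i<k. \<Sum>j<k. (w i * w j)\<^sup>2)"
    by (simp add: I_def sum.cartesian_product case_prod_unfold)
  also have "(\<Sum>i<k. \<Sum>j<k. (w i * w j)\<^sup>2) = (\<Sum>i<k. (w i)\<^sup>2)\<^sup>2"
    by (simp add: power2_eq_square sum_product mult_ac)
  also have "(\<Sum>i<k. \<Sum>j<k. (E i j)\<^sup>2) * (\<Sum>i<k. (w i)\<^sup>2)\<^sup>2 \<le> (\<eta> * (\<Sum>i<k. (w i)\<^sup>2))\<^sup>2"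
    unfolding power_mult_distrib using E by (rule mult_right_mono) simp
  finally show ?thesis
    using \<open>0 \<le> \<eta>\<close> by (simp add: abs_le_square_iff[symmetric] abs_mult sum_nonneg)
qed

text \<open>Converts closeness to the semidefinite cone into membership, at the price of a multiple
  of the identity.\<close>

lemma psd_add_diag:
  assumes sym: "\<And>i j. i < k \<Longrightarrow> j < k \<Longrightarrow> X i j = X j i" and P: "psd k P" and "0 \<le> \<eta>"
    and E: "(\<Sum>i<k. \<Sum>j<k. (X i j - P i j)\<^sup>2) \<le> \<eta>\<^sup>2"
  shows "psd k (\<lambda>i j. X i j + diag_mat (\<lambda>_. \<eta>) i j)"
proof -
  have "0 \<le> quad_form k (\<lambda>i j. X i j + diag_mat (\<lambda>_. \<eta>) i j) w" for w
  proof -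
    have d: "quad_form k (diag_mat (\<lambda>_. \<eta>)) w = \<eta> * (\<Sum>i<k. (w i)\<^sup>2)"
    proof -
      have "quad_form k (diag_mat (\<lambda>_. \<eta>)) w = mat_inner k k (diag_mat (\<lambda>_. \<eta>)) (\<lambda>i j. w i * w j)"
        by (simp add: quad_form_def mat_inner_def mult_ac)
      then show ?thesis by (simp add: mat_inner_diag power2_eq_square sum_distrib_left)
    qed
    have "quad_form k (\<lambda>i j. X i j + diag_mat (\<lambda>_. \<eta>) i j) w
        = quad_form k P w + quad_form k (\<lambda>i j. X i j - P i j) w + quad_form k (diag_mat (\<lambda>_. \<eta>)) w"
      by (simp add: quad_form_def sum.distrib[symmetric] algebra_simps)
    moreover have "\<bar>quad_form k (\<lambda>i j. X i j - P i j) w\<bar> \<le> \<eta> * (\<Sum>i<k. (w i)\<^sup>2)"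
      using E \<open>0 \<le> \<eta>\<close> by (rule abs_quad_form_le)
    moreover have "0 \<le> quad_form k P w" using P by (simp add: psd_iff)
    ultimately show ?thesis using d by linarith
  qed
  then show ?thesis using sym by (auto simp: psd_iff diag_mat_def)
qed

lemma blk_sym: "blk m n A i j = blk m n A j i"
  by (auto simp: blk_def)

text \<open>The set of \<open>v \<ge> 0\<close> for which the \<open>p / (p - 2)\<close>-norms of the two blocks add up to at most 1.
  Described as a polar set it is convex without Minkowski's inequality.\<close>

definition polar_ball :: "real \<Rightarrow> nat \<Rightarrow> nat \<Rightarrow> (nat \<Rightarrow> real) set" where
  "polar_ball p m n = {v. (\<forall>i<m+n. 0 \<le> v i) \<and>
     (\<forall>w. (\<forall>i<m+n. 0 \<le> w i) \<and> (\<Sum>i<m. w i powr (p / 2)) \<le> 1 \<and>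
        (\<Sum>i\<in>{m..<m+n}. w i powr (p / 2)) \<le> 1 \<longrightarrow> (\<Sum>i<m+n. v i * w i) \<le> 1)}"

lemma polar_ball_convex:
  assumes "v \<in> polar_ball p m n" "v' \<in> polar_ball p m n" "0 \<le> s" "s \<le> 1"
  shows "(\<lambda>i. (1 - s) * v i + s * v' i) \<in> polar_ball p m n"
  unfolding polar_ball_def
proof (intro CollectI conjI allI impI)
  fix i assume "i < m + n"
  then show "0 \<le> (1 - s) * v i + s * v' i"
    using assms by (simp add: polar_ball_def)
next
  fix w :: "nat \<Rightarrow> real" assume w: "(\<forall>i<m+n. 0 \<le> w i) \<and> (\<Sum>i<m. w i powr (p / 2)) \<le> 1 \<and>
        (\<Sum>i\<in>{m..<m+n}. w i powr (p / 2)) \<le> 1"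
  have "(\<Sum>i<m+n. ((1 - s) * v i + s * v' i) * w i)
      = (1 - s) * (\<Sum>i<m+n. v i * w i) + s * (\<Sum>i<m+n. v' i * w i)"
    by (simp add: sum_distrib_left sum.distrib algebra_simps sum_subtractf)
  also have "\<dots> \<le> 1"
    using assms w by (intro convex_bound_le) (auto simp: polar_ball_def)
  finally show "(\<Sum>i<m+n. ((1 - s) * v i + s * v' i) * w i) \<le> 1" .
qed

text \<open>Vectors supported on one block are enough to recover the norm of the diagonal on that
  block. Extension by 0 stays in the polar set because its test vectors are bounded on each block
  separately.\<close>

lemma polar_ball_norming:
  assumes p: "p > 2" and I: "I = {..<m} \<or> I = {m..<m+n}" and x: "\<And>i. i < m + n \<Longrightarrow> 0 \<le> x i"
  obtains v where "v \<in> polar_ball p m n"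
    "(\<Sum>i<m+n. v i * x i) = (\<Sum>i\<in>I. x i powr (p / 2)) powr (2 / p)"
proof -
  have I': "finite I" "I \<subseteq> {..<m+n}" using I by auto
  obtain v where v: "\<And>i. 0 \<le> v i"
    "\<And>w. (\<And>i. i \<in> I \<Longrightarrow> 0 \<le> w i) \<Longrightarrow> (\<Sum>i\<in>I. w i powr (p / 2)) \<le> 1 \<Longrightarrow> (\<Sum>i\<in>I. v i * w i) \<le> 1"
    "(\<Sum>i\<in>I. v i * x i) = (\<Sum>i\<in>I. x i powr (p / 2)) powr (2 / p)"
    using powr_norming_vector[OF p I'(1), of x] I'(2) x by blast
  define v' where "v' = (\<lambda>i. if i \<in> I then v i else 0)"
  have sum_eq: "(\<Sum>i<m+n. v' i * w i) = (\<Sum>i\<in>I. v i * w i)" for w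
    using I' by (intro sum.mono_neutral_cong_right) (auto simp: v'_def)
  have "v' \<in> polar_ball p m n"
    unfolding polar_ball_def
  proof (intro CollectI conjI allI impI)
    show "0 \<le> v' i" for i by (simp add: v'_def v(1))
  next
    fix w :: "nat \<Rightarrow> real" assume w: "(\<forall>i<m+n. 0 \<le> w i) \<and> (\<Sum>i<m. w i powr (p / 2)) \<le> 1 \<and>
        (\<Sum>i\<in>{m..<m+n}. w i powr (p / 2)) \<le> 1"
    then show "(\<Sum>i<m+n. v' i * w i) \<le> 1"
      unfolding sum_eq using I I'(2) by (intro v(2)) auto
  qed
  then show ?thesis using that[of v'] by (simp add: sum_eq v(3))
qed

text \<open>The norming vectors of the two blocks glue to one test vector of the polar set, and
  testing \<open>v\<close> against it is exactly the budget constraint of (P).\<close>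

lemma polar_ball_P_feasible:
  assumes p: "p > 2" and v: "v \<in> polar_ball p m n"
    and psd: "psd (m + n) (\<lambda>i j. diag_mat v i j - blk m n Z i j)"
  shows "\<exists>u1 u2 t. P_feasible p m n Z u1 u2 v t"
proof -
  have v1: "0 \<le> v i" if "i \<in> {..<m}" for i using v that by (simp add: polar_ball_def)
  have v2: "0 \<le> v i" if "i \<in> {m..<m+n}" for i using v that by (simp add: polar_ball_def)
  obtain u1 t1 w1 where 1: "\<And>i. 0 \<le> w1 i" "(\<Sum>i<m. w1 i powr (p / 2)) \<le> 1"
    "\<And>i. i \<in> {..<m} \<Longrightarrow> in_Kp p (v i) u1 (t1 i)" "u1 + theta p * (\<Sum>i<m. t1 i) = (\<Sum>i<m. v i * w1 i)"
    by (rule in_Kp_norming[of p "{..<m}" v, OF p finite_lessThan v1]) (assumption, (rule that; assumption))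
  obtain u2 t2 w2 where 2: "\<And>i. 0 \<le> w2 i" "(\<Sum>i\<in>{m..<m+n}. w2 i powr (p / 2)) \<le> 1"
    "\<And>i. i \<in> {m..<m+n} \<Longrightarrow> in_Kp p (v i) u2 (t2 i)"
    "u2 + theta p * (\<Sum>i\<in>{m..<m+n}. t2 i) = (\<Sum>i\<in>{m..<m+n}. v i * w2 i)"
    by (rule in_Kp_norming[of p "{m..<m+n}" v, OF p finite_atLeastLessThan v2]) (assumption, (rule that; assumption))
  define t where "t = (\<lambda>i. if i < m then t1 i else t2 i)"
  define w where "w = (\<lambda>i. if i < m then w1 i else w2 i)"
  have "(\<Sum>i<m+n. v i * w i) \<le> 1"
  proof -
    have "(\<Sum>i<m. w i powr (p / 2)) = (\<Sum>i<m. w1 i powr (p / 2))"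
      "(\<Sum>i\<in>{m..<m+n}. w i powr (p / 2)) = (\<Sum>i\<in>{m..<m+n}. w2 i powr (p / 2))"
      by (auto simp: w_def intro!: sum.cong)
    then show ?thesis using v 1(1,2) 2(1,2) by (simp add: polar_ball_def w_def)
  qed
  moreover have "(\<Sum>i<m+n. v i * w i) = (\<Sum>i<m. v i * w1 i) + (\<Sum>i\<in>{m..<m+n}. v i * w2 i)"
    unfolding sum_split_blocks by (intro arg_cong2[of _ _ _ _ "(+)"] sum.cong) (auto simp: w_def)
  moreover have "(\<Sum>i<m+n. t i) = (\<Sum>i<m. t1 i) + (\<Sum>i\<in>{m..<m+n}. t2 i)"
    unfolding sum_split_blocks by (intro arg_cong2[of _ _ _ _ "(+)"] sum.cong) (auto simp: t_def)
  then have "theta p * (\<Sum>i<m+n. t i) = theta p * (\<Sum>i<m. t1 i) + theta p * (\<Sum>i\<in>{m..<m+n}. t2 i)"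
    by (simp only: distrib_left)
  ultimately have "u1 + u2 + theta p * (\<Sum>i<m+n. t i) \<le> 1"
    using 1(4) 2(4) by linarith
  then have "P_feasible p m n Z u1 u2 v t"
    using 1(3) 2(3) psd by (auto simp: P_feasible_def t_def)
  then show ?thesis by blast
qed

text \<open>If this fails, a separating hyperplane is, up to sign, a positive semidefinite \<open>X\<close>
  whose normalisation violates the bound on the \<open>pv\<close> norm.\<close>

lemma polar_ball_almost_dominates:
  assumes p: "p > 2" "m > 0" "n > 0" and Z: "pv_norm p m n Z \<le> 1" and "\<eta> > 0"
  shows "\<exists>v P. v \<in> polar_ball p m n \<and> psd (m + n) P \<and>
    (\<Sum>i<m+n. \<Sum>j<m+n. (diag_mat v i j - blk m n Z i j - P i j)\<^sup>2) < \<eta>\<^sup>2"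
proof (rule ccontr)
  assume far: "\<not> ?thesis"
  define k where "k = m + n"
  define I where "I = {..<k} \<times> {..<k}"
  define B where "B = blk m n Z"
  define C where "C = {(\<lambda>(i, j). diag_mat v i j - B i j - P i j) | v P. v \<in> polar_ball p m n \<and> psd k P}"
  have mem: "(\<lambda>(i, j). diag_mat v i j - B i j - P i j) \<in> C" if "v \<in> polar_ball p m n" "psd k P" for v P
    using that unfolding C_def by blast
  have zero: "(\<lambda>_. 0) \<in> polar_ball p m n" "psd k (\<lambda>_ _. 0)"
    by (simp_all add: polar_ball_def psd_def)
  obtain y where y: "\<And>x. x \<in> C \<Longrightarrow> \<eta>\<^sup>2 \<le> (\<Sum>z\<in>I. y z * x z)"
  proof (rule separation_from_zero)
    show "finite I" by (simp add: I_def)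
    show "C \<noteq> {}" using mem[OF zero] by auto
  next
    fix x x' and s :: real assume "x \<in> C" "x' \<in> C" and s: "0 \<le> s" "s \<le> 1"
    then obtain v P v' P' where vP: "x = (\<lambda>(i, j). diag_mat v i j - B i j - P i j)"
      "v \<in> polar_ball p m n" "psd k P" "x' = (\<lambda>(i, j). diag_mat v' i j - B i j - P' i j)"
      "v' \<in> polar_ball p m n" "psd k P'"
      unfolding C_def by blast
    have "(\<lambda>(i, j). diag_mat (\<lambda>i. (1 - s) * v i + s * v' i) i j - B i j
        - ((1 - s) * P i j + s * P' i j)) \<in> C"
      using s vP by (intro mem polar_ball_convex psd_sum_scale) auto
    moreover have "(\<lambda>(i, j). diag_mat (\<lambda>i. (1 - s) * v i + s * v' i) i j - B i j
        - ((1 - s) * P i j + s * P' i j)) = (\<lambda>z. (1 - s) * x z + s * x' z)"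
      by (auto simp: vP diag_mat_def algebra_simps)
    ultimately show "(\<lambda>z. (1 - s) * x z + s * x' z) \<in> C" by simp
  next
    fix x assume "x \<in> C"
    then obtain v P where vP: "x = (\<lambda>(i, j). diag_mat v i j - B i j - P i j)"
      "v \<in> polar_ball p m n" "psd k P"
      unfolding C_def by blast
    then have "\<not> (\<Sum>i<k. \<Sum>j<k. (diag_mat v i j - B i j - P i j)\<^sup>2) < \<eta>\<^sup>2"
      using far unfolding k_def B_def by blast
    then show "\<eta>\<^sup>2 \<le> (\<Sum>z\<in>I. (x z)\<^sup>2)"
      by (simp add: vP(1) I_def sum.cartesian_product case_prod_unfold)
  qed (use that in blast)
  \<comment> \<open>Symmetric matrices see only the symmetric part of \<open>y\<close>. The sign is
    such that \<open>X\<close> pairs nonnegatively with the cone.\<close>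
  define X where "X = (\<lambda>i j. - (y (i, j) + y (j, i)) / 2)"
  have Xsym: "X i j = X j i" for i j by (simp add: X_def add.commute)
  have y_X: "(\<Sum>z\<in>I. y z * (case z of (i, j) \<Rightarrow> M i j)) = - mat_inner k k M X"
    if M: "\<And>i j. M i j = M j i" for M
  proof -
    define b where "b = (\<Sum>i<k. \<Sum>j<k. M i j * y (i, j))"
    have "(\<Sum>i<k. \<Sum>j<k. M i j * y (j, i)) = (\<Sum>i<k. \<Sum>j<k. M j i * y (j, i))"
      by (intro sum.cong refl) (simp add: M[of _ "_"])
    also have "\<dots> = b" unfolding b_def by (rule sum.swap)
    finally have swap: "(\<Sum>i<k. \<Sum>j<k. M i j * y (j, i)) = b" .
    have "mat_inner k k M X = (\<Sum>i<k. \<Sum>j<k. - 1 / 2 * (M i j * y (i, j)) + - 1 / 2 * (M i j * y (j, i)))"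
      unfolding mat_inner_def by (intro sum.cong refl) (simp add: X_def field_simps)
    also have "\<dots> = - 1 / 2 * b + - 1 / 2 * b"
      by (simp only: sum.distrib sum_distrib_left[symmetric] swap b_def[symmetric])
    finally have "mat_inner k k M X = - b" by simp
    moreover have "(\<Sum>z\<in>I. y z * (case z of (i, j) \<Rightarrow> M i j)) = b"
      by (simp add: b_def I_def sum.cartesian_product case_prod_unfold mult.commute)
    ultimately show ?thesis by simp
  qed
  have sep: "\<eta>\<^sup>2 + (\<Sum>i<k. v i * X i i) \<le> mat_inner k k B X + mat_inner k k P X"
    if v: "v \<in> polar_ball p m n" and P: "psd k P" "\<And>i j. P i j = P j i" for v P
  proof -
    have "\<eta>\<^sup>2 \<le> - mat_inner k k (\<lambda>i j. diag_mat v i j - B i j - P i j) X"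
      using y[OF mem[OF v P(1)]] P(2) blk_sym[of m n Z]
      by (subst (asm) y_X) (auto simp: diag_mat_def B_def)
    then show ?thesis by (simp add: mat_inner_diff_left mat_inner_diag)
  qed
  have eta2: "\<eta>\<^sup>2 > 0" using \<open>\<eta> > 0\<close> by simp
  define b where "b = mat_inner k k B X"
  have "0 \<le> quad_form k X w" for w
  proof (rule ccontr)
    assume neg: "\<not> 0 \<le> quad_form k X w"
    \<comment> \<open>A direction of negative value would let a rank-one \<open>P\<close>, scaled by
      \<open>s\<close>, push the right side of \<open>sep\<close> down to
      \<open>b - \<bar>b\<bar> \<le> 0\<close>.\<close>
    define s where "s = \<bar>b\<bar> / (- quad_form k X w)"
    have s: "s \<ge> 0" unfolding s_def using neg by (intro divide_nonneg_pos) auto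
    have "quad_form k (\<lambda>i j. s * (w i * w j)) z = s * (\<Sum>i<k. w i * z i)\<^sup>2" for z
      by (simp add: quad_form_def power2_eq_square sum_product sum_distrib_left mult_ac)
    then have "psd k (\<lambda>i j. s * (w i * w j))" using s by (simp add: psd_iff mult_ac)
    then have "\<eta>\<^sup>2 \<le> b + mat_inner k k (\<lambda>i j. s * (w i * w j)) X"
      using sep[OF zero(1), of "\<lambda>i j. s * (w i * w j)"] by (simp add: b_def mult_ac)
    also have "mat_inner k k (\<lambda>i j. s * (w i * w j)) X = s * quad_form k X w"
      by (simp add: mat_inner_def quad_form_def sum_distrib_left mult_ac)
    also have "b + s * quad_form k X w = b - \<bar>b\<bar>" using neg by (simp add: s_def)
    finally show False using eta2 by linarith
  qed
  then have psd: "psd k X" using Xsym by (simp add: psd_iff)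
  define S where "S = (\<lambda>J. (\<Sum>i\<in>J. X i i powr (p / 2)) powr (2 / p))"
  have S_le: "S J + \<eta>\<^sup>2 \<le> b" if J: "J = {..<m} \<or> J = {m..<m+n}" for J
  proof -
    obtain v where v: "v \<in> polar_ball p m n"
      "(\<Sum>i<m+n. v i * X i i) = (\<Sum>i\<in>J. X i i powr (p / 2)) powr (2 / p)"
      using polar_ball_norming[OF p(1) J, of "\<lambda>i. X i i"] psd_diag_nonneg[OF psd] by (auto simp: k_def)
    show ?thesis
      using sep[OF v(1) zero(2)] v(2) by (simp add: b_def S_def k_def mat_inner_def)
  qed
  \<comment> \<open>Lies strictly between both block norms and \<open>b\<close>, and is positive
    even if the diagonal vanishes; so \<open>X / M\<close> is feasible and has value
    \<open>b / M > 1\<close>.\<close>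
  define M where "M = b - \<eta>\<^sup>2 / 2"
  have SM: "S J \<le> M" if "J = {..<m} \<or> J = {m..<m+n}" for J
    using S_le[OF that] eta2 unfolding M_def by linarith
  have "0 \<le> S {..<m}" by (simp add: S_def)
  then have M: "M > 0" using S_le[OF disjI1[OF refl]] eta2 unfolding M_def by linarith
  have "(\<Sum>i\<in>J. \<bar>X i i / M\<bar> powr (p / 2)) \<le> 1" if J: "J = {..<m} \<or> J = {m..<m+n}" for J
  proof -
    have "(\<Sum>i\<in>J. \<bar>X i i / M\<bar> powr (p / 2)) = (\<Sum>i\<in>J. X i i powr (p / 2) / M powr (p / 2))"
      using J psd_diag_nonneg[OF psd] M
      by (intro sum.cong refl) (auto simp: k_def powr_divide)
    also have "\<dots> = S J powr (p / 2) / M powr (p / 2)"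
      using p by (simp add: S_def powr_powr sum_nonneg sum_divide_distrib)
    also have "\<dots> \<le> 1"
    proof -
      have "S J powr (p / 2) \<le> M powr (p / 2)" using SM[OF J] p by (intro powr_mono2) (auto simp: S_def)
      then show ?thesis using M by (simp add: divide_le_eq_1)
    qed
    finally show ?thesis .
  qed
  moreover have "psd k (\<lambda>i j. X i j / M)"
    using psd_sum_scale[OF psd zero(2), of "1 / M" 0] M by simp
  ultimately have "pv_feasible p m n (\<lambda>i j. X i j / M)"
    by (simp add: pv_feasible_def k_def)
  then have "mat_inner k k B (\<lambda>i j. X i j / M) \<le> 1"
    using blk_le_pv_norm[of p m n "\<lambda>i j. X i j / M" Z] p Z by (simp add: k_def B_def)
  then have "b / M \<le> 1"
    using mat_inner_scale[of k k B "1 / M" X] by (simp add: b_def)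
  then have "b \<le> M" using M by (simp add: divide_le_eq)
  then show False using eta2 by (simp add: M_def)
qed

subsection \<open>The dual norm of the relaxation\<close>

lemma blk_scale: "blk m n (\<lambda>i j. c * Z i j) i j = c * blk m n Z i j"
  by (simp add: blk_def)

lemma pv_norm_scale_le:
  assumes p: "p > 0" and c: "0 \<le> c"
    and Z: "\<And>X. pv_feasible p m n X \<Longrightarrow> mat_inner (m + n) (m + n) (blk m n Z) X \<le> b"
  shows "pv_norm p m n (\<lambda>i j. c * Z i j) \<le> c * b"
proof (rule pv_norm_le[OF p])
  fix X assume X: "pv_feasible p m n X"
  have "mat_inner (m + n) (m + n) (blk m n (\<lambda>i j. c * Z i j)) X
      = c * mat_inner (m + n) (m + n) (blk m n Z) X"
    by (simp add: blk_scale mat_inner_def sum_distrib_left mult_ac)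
  then show "mat_inner (m + n) (m + n) (blk m n (\<lambda>i j. c * Z i j)) X \<le> c * b"
    using mult_left_mono[OF Z[OF X] c] by simp
qed

text \<open>Raising \<open>v\<close> by \<open>\<eta>\<close> repairs semidefiniteness. Entries of
  test vectors are at most 1, so this adds at most \<open>\<eta> * real (m + n)\<close> to their
  pairing with \<open>v\<close>, which the scaling of \<open>v\<close> and \<open>Z\<close>
  compensates.\<close>

lemma pv_norm_le_1_P_feasible:
  assumes p: "p > 2" "m > 0" "n > 0" and Z: "pv_norm p m n Z \<le> 1" and \<eta>: "\<eta> > 0"
  shows "\<exists>u1 u2 v t. P_feasible p m n (\<lambda>i j. 1 / (1 + \<eta> * real (m + n)) * Z i j) u1 u2 v t"
proof -
  define c where "c = 1 / (1 + \<eta> * real (m + n))"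
  have c: "c > 0" "c * (1 + \<eta> * real (m + n)) = 1"
    using \<eta> add_pos_nonneg[of 1 "\<eta> * real (m + n)"] by (simp_all add: c_def)
  obtain v P where v: "v \<in> polar_ball p m n" and P: "psd (m + n) P"
    and close: "(\<Sum>i<m+n. \<Sum>j<m+n. (diag_mat v i j - blk m n Z i j - P i j)\<^sup>2) < \<eta>\<^sup>2"
    using polar_ball_almost_dominates[OF p Z \<eta>] by blast
  define v' where "v' = (\<lambda>i. c * (v i + \<eta>))"
  have "psd (m + n) (\<lambda>i j. diag_mat v i j - blk m n Z i j + diag_mat (\<lambda>_. \<eta>) i j)"
    using close P \<eta> blk_sym[of m n Z] by (intro psd_add_diag[of _ _ P]) (auto simp: diag_mat_def)
  then have "psd (m + n) (\<lambda>i j. c * (diag_mat v i j - blk m n Z i j + diag_mat (\<lambda>_. \<eta>) i j) + 0 * P i j)"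
    using c P by (intro psd_sum_scale) auto
  also have "(\<lambda>i j. c * (diag_mat v i j - blk m n Z i j + diag_mat (\<lambda>_. \<eta>) i j) + 0 * P i j)
      = (\<lambda>i j. diag_mat v' i j - blk m n (\<lambda>i j. c * Z i j) i j)"
    by (intro ext) (simp add: diag_mat_def v'_def blk_scale algebra_simps)
  finally have psd: "psd (m + n) (\<lambda>i j. diag_mat v' i j - blk m n (\<lambda>i j. c * Z i j) i j)" .
  have "v' \<in> polar_ball p m n"
    unfolding polar_ball_def
  proof (intro CollectI conjI allI impI)
    fix i assume "i < m + n"
    then show "0 \<le> v' i" using v c \<eta> by (simp add: v'_def polar_ball_def)
  next
    fix w :: "nat \<Rightarrow> real" assume w: "(\<forall>i<m+n. 0 \<le> w i) \<and> (\<Sum>i<m. w i powr (p / 2)) \<le> 1 \<and>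
        (\<Sum>i\<in>{m..<m+n}. w i powr (p / 2)) \<le> 1"
    have vw: "(\<Sum>i<m+n. v i * w i) \<le> 1" using v w by (simp add: polar_ball_def)
    have "w i \<le> 1" if "i < m + n" for i
    proof -
      define J where "J = (if i < m then {..<m} else {m..<m+n})"
      have J: "finite J" "i \<in> J" "J \<subseteq> {..<m+n}" "(\<Sum>i\<in>J. w i powr (p / 2)) \<le> 1"
        using that w by (auto simp: J_def)
      have "(\<Sum>i\<in>J. \<bar>w i\<bar> powr (p / 2)) = (\<Sum>i\<in>J. w i powr (p / 2))"
        using J(3) w by (intro sum.cong refl) auto
      then have "\<bar>w i\<bar> \<le> 1" using J p by (intro powr_sum_entry_le_1[of "p / 2" J]) auto
      then show ?thesis by linarith
    qed
    then have "(\<Sum>i<m+n. w i) \<le> (\<Sum>i<m+n. 1)" by (intro sum_mono) auto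
    then have "\<eta> * (\<Sum>i<m+n. w i) \<le> \<eta> * real (m + n)" using \<eta> by (intro mult_left_mono) auto
    then have "(\<Sum>i<m+n. v i * w i) + \<eta> * (\<Sum>i<m+n. w i) \<le> 1 + \<eta> * real (m + n)"
      using vw by linarith
    then have "c * ((\<Sum>i<m+n. v i * w i) + \<eta> * (\<Sum>i<m+n. w i)) \<le> c * (1 + \<eta> * real (m + n))"
      using c by (intro mult_left_mono) auto
    moreover have "(\<Sum>i<m+n. v' i * w i) = c * ((\<Sum>i<m+n. v i * w i) + \<eta> * (\<Sum>i<m+n. w i))"
      by (simp add: v'_def sum_distrib_left sum.distrib algebra_simps)
    ultimately show "(\<Sum>i<m+n. v' i * w i) \<le> 1" using c(2) by simp
  qed
  then show ?thesis using polar_ball_P_feasible[OF p(1) _ psd] unfolding c_def by blast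
qed

lemma mat_inner_le_pu_norm:
  assumes p: "p > 2" "m > 0" "n > 0" and Z: "pv_norm p m n Z \<le> 1"
  shows "mat_inner m n A Z \<le> pu_norm p m n A"
  unfolding pu_norm_def
proof (rule cSup_upper)
  have "mat_inner m n A Z \<le> nuclear_pnorm p m n A" if "pv_norm p m n Z \<le> 1" for Z
    using that spectral_le_pv_norm[of p m n Z] p by (intro mat_inner_le_nuclear_pnorm) auto
  then show "bdd_above {mat_inner m n A Z | Z. pv_norm p m n Z \<le> 1}"
    by (intro bdd_aboveI[of _ "nuclear_pnorm p m n A"]) blast
qed (use Z in blast)

lemma pv_norm_zero_le_1: "p > 0 \<Longrightarrow> pv_norm p m n (\<lambda>_ _. 0) \<le> 1"
  by (intro pv_norm_le) (simp_all add: mat_inner_blk)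

lemma pu_norm_le:
  assumes "p > 0" "\<And>Z. pv_norm p m n Z \<le> 1 \<Longrightarrow> mat_inner m n A Z \<le> c"
  shows "pu_norm p m n A \<le> c"
  unfolding pu_norm_def
  using assms(2) pv_norm_zero_le_1[OF assms(1), of m n] by (intro cSup_least) blast+

lemma pu_norm_le_nuclear:
  assumes p: "p > 2" "m > 0" "n > 0"
  shows "pu_norm p m n A \<le> nuclear_pnorm p m n A"
proof (rule pu_norm_le)
  fix Z assume "pv_norm p m n Z \<le> 1"
  then show "mat_inner m n A Z \<le> nuclear_pnorm p m n A"
    using spectral_le_pv_norm[of p m n Z] p by (intro mat_inner_le_nuclear_pnorm) auto
qed (use p in simp)

text \<open>Certificates exist only for levels below the nuclear norm, hence the intermediate
  \<open>L\<close>. Divided by the Grothendieck constant, a certificate becomes admissible for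
  pu.\<close>

lemma nuclear_le_grothendieck_pu:
  assumes p: "p > 2" "m > 0" "n > 0"
  shows "nuclear_pnorm p m n A \<le> grothendieck_constant * pu_norm p m n A"
proof (rule ccontr)
  assume "\<not> ?thesis"
  then obtain L where L: "grothendieck_constant * pu_norm p m n A < L" "L < nuclear_pnorm p m n A"
    using dense[of "grothendieck_constant * pu_norm p m n A" "nuclear_pnorm p m n A"] by auto
  define K where "K = grothendieck_constant"
  have K: "K > 0" using grothendieck_constant_ge_1 by (simp add: K_def)
  have "mat_inner m n A (\<lambda>_ _. 0) \<le> pu_norm p m n A"
    using p by (intro mat_inner_le_pu_norm pv_norm_zero_le_1) auto
  then have "0 \<le> K * pu_norm p m n A" using K by (simp add: mat_inner_def)
  then have "L > 0" using L by (simp add: K_def)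
  then obtain Z where Z: "spectral_pnorm p m n Z \<le> 1" "mat_inner m n A Z = L"
    using nuclear_dual_witness[of p m n L A] L p by auto
  have "pv_norm p m n (\<lambda>i j. 1 / K * Z i j) \<le> 1 / K * (K * spectral_pnorm p m n Z)"
    using blk_le_grothendieck_spectral[of p m n _ Z] p K by (intro pv_norm_scale_le) (auto simp: K_def)
  also have "\<dots> \<le> 1" using K Z(1) by simp
  finally have "mat_inner m n A (\<lambda>i j. 1 / K * Z i j) \<le> pu_norm p m n A"
    using p by (intro mat_inner_le_pu_norm)
  then have "L \<le> K * pu_norm p m n A"
    unfolding mat_inner_scale Z(2) using K by (simp add: field_simps)
  then show False using L by (simp add: K_def)
qed

lemma pu_norm_eq_P_value:
  assumes p: "p > 2" "m > 0" "n > 0"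
  shows "pu_norm p m n A = P_value p m n A"
proof (rule antisym)
  define F where "F = {mat_inner m n A Z | Z u1 u2 v t. P_feasible p m n Z u1 u2 v t}"
  have F_le: "x \<le> pu_norm p m n A" if "x \<in> F" for x
    using that P_feasible_pv_norm_le_1[OF p] mat_inner_le_pu_norm[OF p] unfolding F_def by blast
  then have "bdd_above F" by (rule bdd_aboveI)
  have mem: "mat_inner m n A (\<lambda>i j. 1 / (1 + \<eta> * real (m + n)) * Z i j) \<in> F"
    if "pv_norm p m n Z \<le> 1" "\<eta> > 0" for Z \<eta>
    using pv_norm_le_1_P_feasible[OF p that] unfolding F_def by blast
  have le_value: "mat_inner m n A Z / (1 + \<eta> * real (m + n)) \<le> P_value p m n A"
    if "pv_norm p m n Z \<le> 1" "\<eta> > 0" for Z \<eta>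
  proof -
    have "mat_inner m n A (\<lambda>i j. 1 / (1 + \<eta> * real (m + n)) * Z i j) \<le> P_value p m n A"
      unfolding P_value_def F_def[symmetric] using mem[OF that] \<open>bdd_above F\<close> by (rule cSup_upper)
    then show ?thesis unfolding mat_inner_scale by simp
  qed
  have zero: "pv_norm p m n (\<lambda>_ _. 0) \<le> 1" using p by (intro pv_norm_zero_le_1) auto
  have "F \<noteq> {}" using mem[OF zero, of 1] by force
  then show "P_value p m n A \<le> pu_norm p m n A"
    unfolding P_value_def F_def[symmetric] using F_le by (rule cSup_least)
  have V0: "0 \<le> P_value p m n A" using le_value[OF zero, of 1] by (simp add: mat_inner_def)
  show "pu_norm p m n A \<le> P_value p m n A"
  proof (rule pu_norm_le)
    fix Z assume Z: "pv_norm p m n Z \<le> 1"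
    show "mat_inner m n A Z \<le> P_value p m n A"
    proof (rule field_le_epsilon)
      fix e :: real assume "e > 0"
      define N where "N = real (m + n)"
      \<comment> \<open>Makes the relative error \<open>\<eta> * N\<close> times the value of (P) at
        most \<open>e\<close>; adding 1 covers the value 0.\<close>
      define \<eta> where "\<eta> = e / (N * (P_value p m n A + 1))"
      have N: "N > 0" using p by (simp add: N_def)
      have \<eta>: "\<eta> > 0" using \<open>e > 0\<close> N V0 by (simp add: \<eta>_def)
      have "0 < 1 + \<eta> * N" using N \<eta> by (intro add_pos_pos mult_pos_pos) auto
      then have "mat_inner m n A Z \<le> P_value p m n A * (1 + \<eta> * N)"
        using le_value[OF Z \<eta>] unfolding N_def[symmetric] by (simp only: pos_divide_le_eq)
      also have "\<dots> = P_value p m n A + e * (P_value p m n A / (P_value p m n A + 1))"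
      proof -
        have "\<eta> * N = e / (P_value p m n A + 1)" using N by (simp add: \<eta>_def)
        then show ?thesis by (simp add: distrib_left)
      qed
      also have "\<dots> \<le> P_value p m n A + e * 1"
        using \<open>e > 0\<close> V0 by (intro add_left_mono mult_left_mono) auto
      also have "\<dots> = P_value p m n A + e" by simp
      finally show "mat_inner m n A Z \<le> P_value p m n A + e" .
    qed
  qed (use p in simp)
qed

theorem theorem3p8:
  fixes p :: real and m n :: nat and A :: "nat \<Rightarrow> nat \<Rightarrow> real"
  assumes "m > 0" and "n > 0"
    and "p \<in> \<rat>" and "p > 2"
  shows "pu_norm p m n A = P_value p m n A
    \<and> pu_norm p m n A \<le> nuclear_pnorm p m n A
    \<and> nuclear_pnorm p m n A \<le> grothendieck_constant * pu_norm p m n A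
    \<and> (\<forall>Z u1 u2 v t. P_feasible p m n Z u1 u2 v t \<and> mat_inner m n A Z = P_value p m n A \<longrightarrow>
          spectral_pnorm p m n Z \<le> 1 \<and>
          mat_inner m n A Z \<ge> nuclear_pnorm p m n A / grothendieck_constant)"
proof (intro conjI allI impI)
  note p = \<open>p > 2\<close> \<open>m > 0\<close> \<open>n > 0\<close>
  show val: "pu_norm p m n A = P_value p m n A" by (rule pu_norm_eq_P_value[OF p])
  show "pu_norm p m n A \<le> nuclear_pnorm p m n A" by (rule pu_norm_le_nuclear[OF p])
  show nuc: "nuclear_pnorm p m n A \<le> grothendieck_constant * pu_norm p m n A"
    by (rule nuclear_le_grothendieck_pu[OF p])
  fix Z u1 u2 v t
  assume Z: "P_feasible p m n Z u1 u2 v t \<and> mat_inner m n A Z = P_value p m n A"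
  then have "pv_norm p m n Z \<le> 1" using P_feasible_pv_norm_le_1[OF p] by blast
  then show "spectral_pnorm p m n Z \<le> 1" using spectral_le_pv_norm[of p m n Z] p by simp
  show "nuclear_pnorm p m n A / grothendieck_constant \<le> mat_inner m n A Z"
    using nuc Z val grothendieck_constant_ge_1 by (simp add: pos_divide_le_eq mult.commute)
qed

end
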